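(* For every $n\ge 1$, the number of noncrossing arc diagrams on $n$ points all of whose arcs are left arcs or right arcs equals the Baxter number \[B(n)=\binom{n+1}{1}^{-1}\binom{n+1}{2}^{-1}\sum_{k=0}^{n-1}\binom{n+1}{k}\binom{n+1}{k+1}\binom{n+1}{k+2}.\]
   Context: Place $n$ distinct points on a vertical line, identified with $1,\ldots,n$ from bottom to top. An arc connects a point $p$ to a strictly higher point $q$, moving monotonically upward from $p$ to $q$ and passing either to the left or to the right of each point strictly between $p$ and $q$ (it may pass left of some and right of others). Arcs are considered only up to combinatorial equivalence: an arc is determined by its two endpoints and by which of the points strictly between them lie to its left. A noncrossing arc diagram on $n$ points is a collection of (zero or more) such arcs drawn so that (C1) no two arcs intersect except possibly at their endpoints, and (C2) no two arcs share the same upper endpoint or the same lower endpoint; diagrams are considered up to combinatorial equivalence, i.e. a diagram is determined by which pairs of points are joined by arcs and which points are left/right of each arc. A left arc is an arc that does not pass to the right of any point; a right arc is an arc that does not pass to the left of any point. *)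

theory Defs
  imports "HOL-Analysis.Analysis"
begin

definition points :: "nat \<Rightarrow> (real \<times> real) set" where
  "points n = (\<lambda>i. (0, real i)) ` {1..n}"

text \<open>
  A drawn arc is a path in the plane whose height is strictly increasing; its start is its lower
  endpoint, its finish its upper endpoint, and it avoids all other points.
\<close>

definition drawn_arc :: "nat \<Rightarrow> (real \<Rightarrow> real \<times> real) \<Rightarrow> bool" where
  "drawn_arc n \<gamma> \<longleftrightarrow>
     path \<gamma> \<and> strict_mono_on {0..1} (\<lambda>t. snd (\<gamma> t)) \<and>
     pathstart \<gamma> \<in> points n \<and> pathfinish \<gamma> \<in> points n \<and>
     (\<forall>t\<in>{0<..<1}. \<gamma> t \<notin> points n)"

definition passes_left_of :: "(real \<Rightarrow> real \<times> real) \<Rightarrow> real \<times> real \<Rightarrow> bool" where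
  "passes_left_of \<gamma> v \<longleftrightarrow> (\<exists>z\<in>path_image \<gamma>. snd z = snd v \<and> fst z < fst v)"

definition passes_right_of :: "(real \<Rightarrow> real \<times> real) \<Rightarrow> real \<times> real \<Rightarrow> bool" where
  "passes_right_of \<gamma> v \<longleftrightarrow> (\<exists>z\<in>path_image \<gamma>. snd z = snd v \<and> fst v < fst z)"

definition left_arc :: "nat \<Rightarrow> (real \<Rightarrow> real \<times> real) \<Rightarrow> bool" where
  "left_arc n \<gamma> \<longleftrightarrow> (\<forall>v\<in>points n. \<not> passes_right_of \<gamma> v)"

definition right_arc :: "nat \<Rightarrow> (real \<Rightarrow> real \<times> real) \<Rightarrow> bool" where
  "right_arc n \<gamma> \<longleftrightarrow> (\<forall>v\<in>points n. \<not> passes_left_of \<gamma> v)"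

text \<open>
  The combinatorial data of a drawn arc: its two endpoints and the points lying to its left,
  i.e. those that it passes to the right of.  Two drawn arcs are combinatorially equivalent iff
  these data agree.
\<close>

definition arc_class ::
  "nat \<Rightarrow> (real \<Rightarrow> real \<times> real) \<Rightarrow> (real \<times> real) \<times> (real \<times> real) \<times> (real \<times> real) set" where
  "arc_class n \<gamma> = (pathstart \<gamma>, pathfinish \<gamma>, {v\<in>points n. passes_right_of \<gamma> v})"

definition noncrossing_drawing :: "nat \<Rightarrow> (real \<Rightarrow> real \<times> real) set \<Rightarrow> bool" where
  "noncrossing_drawing n \<Gamma> \<longleftrightarrow>
     (\<forall>\<gamma>\<in>\<Gamma>. drawn_arc n \<gamma>) \<and>
     (\<forall>\<gamma>\<in>\<Gamma>. \<forall>\<delta>\<in>\<Gamma>. \<gamma> \<noteq> \<delta> \<longrightarrow>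
        path_image \<gamma> \<inter> path_image \<delta>
          \<subseteq> {pathstart \<gamma>, pathfinish \<gamma>} \<inter> {pathstart \<delta>, pathfinish \<delta>} \<and>
        pathstart \<gamma> \<noteq> pathstart \<delta> \<and> pathfinish \<gamma> \<noteq> pathfinish \<delta>)"

text \<open>
  The combinatorial equivalence class of a drawing is represented by the set of classes of its arcs.
  No multiplicity is lost: distinct arcs of a noncrossing drawing have different endpoints.
  Being a left or a right arc depends only on the class of the arc.
\<close>

definition left_right_diagrams ::
  "nat \<Rightarrow> ((real \<times> real) \<times> (real \<times> real) \<times> (real \<times> real) set) set set" where
  "left_right_diagrams n =
     {arc_class n ` \<Gamma> | \<Gamma>. noncrossing_drawing n \<Gamma> \<and> (\<forall>\<gamma>\<in>\<Gamma>. left_arc n \<gamma> \<or> right_arc n \<gamma>)}"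

definition baxter_number :: "nat \<Rightarrow> real" where
  "baxter_number n =
     inverse (real ((n + 1) choose 1)) * inverse (real ((n + 1) choose 2)) *
     (\<Sum>k = 0..n - 1. real ((n + 1) choose k) * real ((n + 1) choose (k + 1)) * real ((n + 1) choose (k + 2)))"

end

theory Submission imports Defs begin

text \<open>
  A left arc and a right arc can only meet at common endpoints, so a diagram is a pair of noncrossing
  matchings, one for each side, with disjoint sets of lower endpoints and disjoint sets of upper
  endpoints; these can be drawn with parabolas.  A noncrossing matching is determined by its sets of
  lower and upper endpoints, which are subject only to a ballot condition.  Reading the points from
  bottom to top and recording the numbers of left and right arcs currently open, a diagram becomes a
  closed walk in the quarter plane with eight steps: six of them are the roots of \<open>A\<^sub>2\<close> and two are
  zero.  The gaps between three nonintersecting walkers on the line, each of which advances by 0 or 1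
  at each time, move in the same way, so these walks are counted by sums of 3 by 3 determinants of
  binomial coefficients, and each determinant evaluates to one summand of the Baxter number.
\<close>

section \<open>Nonintersecting walkers and walks in the quarter plane\<close>

text \<open>The lower index is an integer so that determinant entries may step below 0; the value 0
  there makes Pascal's rule hold for every \<open>d\<close>.\<close>

definition binom :: "nat \<Rightarrow> int \<Rightarrow> int" where
  "binom m d = (if d < 0 then 0 else int (m choose nat d))"

lemma binom_0: "binom 0 d = (if d = 0 then 1 else 0)"
  by (auto simp: binom_def)

lemma binom_Suc: "binom (Suc m) d = binom m d + binom m (d - 1)"
proof (cases "d \<le> 0")
  case True
  then show ?thesis by (auto simp: binom_def)
next
  case False
  then obtain k where k: "d = int (Suc k)"
    by (metis not_le zero_less_imp_eq_int gr0_implies_Suc)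
  show ?thesis unfolding k by (simp add: binom_def nat_add_distrib)
qed

lemma binom_eq_0: "d < 0 \<or> d > int m \<Longrightarrow> binom m d = 0"
  by (auto simp: binom_def intro!: binomial_eq_0)

text \<open>
  The Lindstroem-Gessel-Viennot determinant: for \<open>x > y > z\<close> it counts the ways in which three
  nonintersecting walkers get from \<open>(x, y, z)\<close> to \<open>(2, 1, 0)\<close> in \<open>m\<close> rounds.
\<close>

definition walker_det :: "nat \<Rightarrow> int \<Rightarrow> int \<Rightarrow> int \<Rightarrow> int" where
  "walker_det m x y z =
     binom m (2 - x) * (binom m (1 - y) * binom m (- z) - binom m (- y) * binom m (1 - z))
   - binom m (1 - x) * (binom m (2 - y) * binom m (- z) - binom m (- y) * binom m (2 - z))
   + binom m (- x) * (binom m (2 - y) * binom m (1 - z) - binom m (1 - y) * binom m (2 - z))"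

text \<open>Pascal's rule splits each row of the matrix into the row at \<open>w\<close> plus the
  row at \<open>w + 1\<close>; multilinearity in the three rows gives one term for each set of
  walkers that advance in the first round.\<close>

lemma walker_det_Suc:
  "walker_det (Suc m) x y z =
     walker_det m x y z + walker_det m (x+1) y z + walker_det m x (y+1) z + walker_det m x y (z+1)
   + walker_det m (x+1) (y+1) z + walker_det m (x+1) y (z+1) + walker_det m x (y+1) (z+1)
   + walker_det m (x+1) (y+1) (z+1)"
proof -
  have e: "2 - (w + 1) = 1 - w" "1 - (w + 1) = - w" "- (w + 1) = - w - 1" for w :: int by auto
  have s: "binom (Suc m) (2 - w) = binom m (2 - w) + binom m (1 - w)"
    "binom (Suc m) (1 - w) = binom m (1 - w) + binom m (- w)"
    "binom (Suc m) (- w) = binom m (- w) + binom m (- w - 1)" for w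
    using binom_Suc[of m "2 - w"] binom_Suc[of m "1 - w"] binom_Suc[of m "- w"] by (simp_all add: algebra_simps)
  show ?thesis unfolding walker_det_def e s by algebra
qed

text \<open>Two rows are equal. This is the wall condition that removes colliding walkers.\<close>

lemma walker_det_wall: "walker_det m x x z = 0" "walker_det m x y y = 0"
  by (simp_all add: walker_det_def algebra_simps)

lemma walker_det_0:
  assumes "x > y" "y > z"
  shows "walker_det 0 x y z = (if x = 2 \<and> y = 1 \<and> z = 0 then 1 else 0)"
  using assms by (auto simp: walker_det_def binom_0)

text \<open>An entire row vanishes: a walker above 2 is past every target, and one below
  \<open>- m\<close> cannot reach any target in \<open>m\<close> rounds. Sums over all translations
  are therefore finite.\<close>

lemma walker_det_eq_0:
  assumes "x > 2 \<or> x < - int m \<or> y > 2 \<or> y < - int m \<or> z > 2 \<or> z < - int m"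
  shows "walker_det m x y z = 0"
proof -
  have "binom m (2 - w) = 0 \<and> binom m (1 - w) = 0 \<and> binom m (- w) = 0" if "w > 2 \<or> w < - int m" for w
    using that by (auto intro!: binom_eq_0)
  from this[of x] this[of y] this[of z] show ?thesis using assms by (auto simp: walker_det_def)
qed

section \<open>Walks in the quarter plane as sums of determinants\<close>

text \<open>Walks of \<open>m\<close> steps from \<open>(i, j)\<close> to the origin, by their first
  step. The factor 2 stands for the two zero steps; the guards remove steps that leave the
  quadrant.\<close>

fun walks :: "nat \<Rightarrow> nat \<Rightarrow> nat \<Rightarrow> nat" where
  "walks 0 i j = (if i = 0 \<and> j = 0 then 1 else 0)"
| "walks (Suc m) i j =
     2 * walks m i j + walks m (Suc i) j + walks m i (Suc j)
   + (if i = 0 then 0 else walks m (i - 1) j + walks m (i - 1) (Suc j))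
   + (if j = 0 then 0 else walks m i (j - 1) + walks m (Suc i) (j - 1))"

text \<open>Translating the window trades the term at \<open>a\<close> for the one at
  \<open>b + 1\<close>, and both are 0. This restores the normal form after the middle walker has
  advanced.\<close>

lemma sum_shift_vanishing:
  fixes f :: "int \<Rightarrow> int"
  assumes "f a = 0" "f (b + 1) = 0" "a \<le> b"
  shows "(\<Sum>t=a..b. f (t + 1)) = (\<Sum>t=a..b. f t)"
proof -
  have "(\<Sum>t=a..b. f (t + 1)) = sum f {a+1..b+1}"
    by (rule sum.reindex_bij_witness[of _ "\<lambda>t. t - 1" "\<lambda>t. t + 1"]) auto
  also have "\<dots> = sum f {a..b+1}"
    using assms by (intro sum.mono_neutral_left) (auto simp: not_le dest: le_less_trans)
  also have "\<dots> = sum f {a..b}"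
  proof (rule sum.mono_neutral_right)
    show "\<forall>i\<in>{a..b + 1} - {a..b}. f i = 0"
    proof
      fix i assume "i \<in> {a..b + 1} - {a..b}"
      then have "i = b + 1" by auto
      then show "f i = 0" using assms by simp
    qed
  qed auto
  finally show ?thesis .
qed

text \<open>
  A walk at \<open>(i, j)\<close> corresponds to walkers with \<open>x - y = i + 1\<close> and \<open>y - z = j + 1\<close>, and \<open>t\<close> is their
  common translation.  All nonzero summands lie within the bounds, which do not depend on \<open>m\<close> so that
  the induction goes through.
\<close>

lemma walks_eq_sum_walker_det:
  assumes "m \<le> K"
  shows "int (walks m i j) =
    (\<Sum>t = - int K - 2..2. walker_det m (t + int i + 2) (t + 1) (t - int j))"
  using assms
proof (induction m arbitrary: i j)
  case 0
  have "(\<Sum>t = - int K - 2..2. walker_det 0 (t + int i + 2) (t + 1) (t - int j))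
    = (\<Sum>t = - int K - 2..2. if t = 0 then (if i = 0 \<and> j = 0 then 1 else 0) else 0)"
    by (rule sum.cong[OF refl], subst walker_det_0) auto
  then show ?case by simp
next
  case (Suc m)
  let ?I = "{- int K - 2..2::int}"
  \<comment> \<open>Here \<open>x\<close> and \<open>z\<close> are arbitrary integers, so that the
    forbidden gaps \<open>i = -1\<close> and \<open>j = -1\<close> are covered too: they are
    \<open>G 1 z\<close> and \<open>G x 1\<close>.\<close>
  define F where "F x z t = walker_det m (t + x) (t + 1) (t + z)" for x z t
  define G where "G x z = sum (F x z) ?I" for x z
  have IH: "int (walks m i j) = G (int i + 2) (- int j)" for i j
    using Suc unfolding G_def F_def by (simp add: algebra_simps)
  \<comment> \<open>The middle coordinate \<open>t + 1\<close> is \<open>- K - 1\<close> at the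
    lower bound and 4 just above the upper one, so \<open>F\<close> vanishes at both for all
    \<open>x\<close> and \<open>z\<close>.\<close>
  have shift: "(\<Sum>t\<in>?I. F x z (t + 1)) = G x z" for x z
    unfolding G_def
    using Suc.prems by (intro sum_shift_vanishing) (auto simp: F_def intro!: walker_det_eq_0)
  have G0: "G 1 z = 0" "G x 1 = 0" for x z
    unfolding G_def F_def by (simp_all add: walker_det_wall)
  define x where "x = int i + 2"
  define z where "z = - int j"
  \<comment> \<open>Terms in which the middle walker advances are written at \<open>t + 1\<close>,
    so that its coordinate is again the translation plus 1 and the gaps change instead.\<close>
  have "(\<Sum>t\<in>?I. walker_det (Suc m) (t + int i + 2) (t + 1) (t - int j))
    = (\<Sum>t\<in>?I. F x z t + F (x+1) z t + F (x-1) (z-1) (t+1) + F x (z+1) t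
        + F x (z-1) (t+1) + F (x+1) (z+1) t + F (x-1) z (t+1) + F x z (t+1))"
    by (rule sum.cong[OF refl]) (simp add: walker_det_Suc F_def x_def z_def algebra_simps)
  also have "\<dots> = G x z + G (x+1) z + G (x-1) (z-1) + G x (z+1)
        + G x (z-1) + G (x+1) (z+1) + G (x-1) z + G x z"
    by (simp add: sum.distrib shift) (simp add: G_def)
  also have "\<dots> = int (walks (Suc m) i j)"
  proof -
    have "G (x+1) z = int (walks m (Suc i) j)" "G x (z-1) = int (walks m i (Suc j))"
      using IH[of "Suc i" j] IH[of i "Suc j"] by (simp_all add: x_def z_def minus_diff_commute add.commute)
    moreover have "G (x-1) (z-1) + G (x-1) z =
        int (if i = 0 then 0 else walks m (i - 1) j + walks m (i - 1) (Suc j))"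
      using G0 IH[of "i - 1" j] IH[of "i - 1" "Suc j"]
      by (cases i) (simp_all add: x_def z_def minus_diff_commute add.commute)
    moreover have "G x (z+1) + G (x+1) (z+1) =
        int (if j = 0 then 0 else walks m i (j - 1) + walks m (Suc i) (j - 1))"
      using G0 IH[of i "j - 1"] IH[of "Suc i" "j - 1"]
      by (cases j) (simp_all add: x_def z_def minus_diff_commute add.commute)
    ultimately show ?thesis by (simp add: IH[of i j] x_def[symmetric] z_def[symmetric])
  qed
  finally show ?case by simp
qed

section \<open>Evaluation of the determinant\<close>

lemma binom_absorb: "(real_of_int d + 1) * real_of_int (binom m (d + 1)) = (real m - real_of_int d) * real_of_int (binom m d)"
proof (cases "d < 0")
  case True
  then show ?thesis by (cases "d = -1") (auto simp: binom_def)
next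
  case False
  then obtain r where d: "d = int r" by (metis not_less nonneg_int_cases)
  have "Suc r * (m choose Suc r) = (m - r) * (m choose r)"
    by (metis binomial_absorb_comp binomial_absorption diff_Suc_1)
  then have "real (Suc r * (m choose Suc r)) = real ((m - r) * (m choose r))" by simp
  then show ?thesis
    by (cases "r \<le> m") (auto simp: d binom_def nat_add_distrib of_nat_diff binomial_eq_0 algebra_simps)
qed

text \<open>The matrix is Toeplitz with entries \<open>binom m (k + d)\<close> for \<open>d\<close>
  from -2 to 2. Absorption makes all of them rational multiples of \<open>binom m k\<close>, and
  Pascal's rule applied twice does the same for the binomials of \<open>m + 2\<close>. What remains
  is an identity of rational functions in \<open>k\<close> and \<open>m - k\<close>.\<close>

lemma binomial_toeplitz_det:
  assumes "k \<le> m"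
  shows "real_of_int (walker_det m (2 - int k) (1 - int k) (- int k)) =
    inverse (real (m + 2)) * inverse (real ((m + 2) choose 2)) *
    (real ((m + 2) choose k) * real ((m + 2) choose (k + 1)) * real ((m + 2) choose (k + 2)))"
proof -
  define B where "B d = real_of_int (binom m (int k + d))" for d
  \<comment> \<open>Both \<open>K\<close> and \<open>L\<close> are nonnegative, so the denominators
    \<open>K + 1\<close>, \<open>K + 2\<close>, \<open>L + 1\<close> and \<open>L + 2\<close> below
    are never 0.\<close>
  define a K L where "a = B 0" and "K = real k" and "L = real m - real k"
  have KL: "K \<ge> 0" "L \<ge> 0" "real m = K + L" using assms by (simp_all add: K_def L_def)
  have rel: "(K + real_of_int d + 1) * B (d + 1) = (L - real_of_int d) * B d" for d
    using binom_absorb[of "int k + d" m] by (simp add: B_def K_def L_def algebra_simps)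
  have b1: "B 1 = L * a / (K + 1)"
    using rel[of 0] KL by (simp add: a_def field_simps)
  have b2: "B 2 = (L - 1) * B 1 / (K + 2)"
    using rel[of 1] KL by (simp add: field_simps)
  have c1: "B (-1) = K * a / (L + 1)"
    using rel[of "-1"] KL by (simp add: a_def field_simps)
  have c2: "B (-2) = (K - 1) * B (-1) / (L + 2)"
    using rel[of "-2"] KL by (simp add: field_simps)
  have up: "real ((m + 2) choose r) = real_of_int (binom (Suc (Suc m)) (int r))" for r
    by (simp add: binom_def)
  have e0: "real ((m + 2) choose k) = B 0 + 2 * B (-1) + B (-2)"
    unfolding up by (simp add: binom_Suc B_def)
  have e1: "real ((m + 2) choose (k + 1)) = B 1 + 2 * B 0 + B (-1)"
    unfolding up by (simp add: binom_Suc B_def algebra_simps)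
  have e2: "real ((m + 2) choose (k + 2)) = B 2 + 2 * B 1 + B 0"
    unfolding up by (simp add: binom_Suc B_def algebra_simps)
  have f0: "B 0 + 2 * B (-1) + B (-2) = a * (K + L + 1) * (K + L + 2) / ((L + 1) * (L + 2))"
    unfolding c2 c1 a_def[symmetric] using KL by (simp add: divide_simps) (simp add: algebra_simps)
  have f1: "B 1 + 2 * B 0 + B (-1) = a * (K + L + 1) * (K + L + 2) / ((K + 1) * (L + 1))"
    unfolding b1 c1 a_def[symmetric] using KL by (simp add: divide_simps) (simp add: algebra_simps)
  have f2: "B 2 + 2 * B 1 + B 0 = a * (K + L + 1) * (K + L + 2) / ((K + 1) * (K + 2))"
    unfolding b2 b1 a_def[symmetric] using KL by (simp add: divide_simps) (simp add: algebra_simps)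
  have ch: "real ((m + 2) choose 2) = (K + L + 2) * (K + L + 1) / 2"
    using KL by (simp add: choose_two real_of_nat_div) (simp add: algebra_simps)
  have "real_of_int (walker_det m (2 - int k) (1 - int k) (- int k)) =
      B 0 * (B 0 * B 0 - B (-1) * B 1) - B (-1) * (B 1 * B 0 - B (-1) * B 2)
      + B (-2) * (B 1 * B 1 - B 0 * B 2)"
    by (simp add: walker_det_def B_def algebra_simps)
  \<comment> \<open>The three minors are simplified one at a time inside the running
    expression.\<close>
  also have "B 0 * B 0 - B (-1) * B 1 = a\<^sup>2 * (K + L + 1) / ((K + 1) * (L + 1))"
    unfolding b1 c1 a_def[symmetric] using KL by (simp add: divide_simps) (simp add: algebra_simps power2_eq_square)
  also have "B 1 * B 0 - B (-1) * B 2 = 2 * a\<^sup>2 * L * (K + L + 1) / ((K + 1) * (K + 2) * (L + 1))"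
    unfolding b2 b1 c1 a_def[symmetric] using KL by (simp add: divide_simps) (simp add: algebra_simps power2_eq_square)
  also have "B 1 * B 1 - B 0 * B 2 = a\<^sup>2 * L * (K + L + 1) / ((K + 1)\<^sup>2 * (K + 2))"
    unfolding b2 b1 a_def[symmetric] using KL by (simp add: divide_simps power2_eq_square) (simp add: algebra_simps)
  also have "B 0 * (a\<^sup>2 * (K + L + 1) / ((K + 1) * (L + 1)))
      - B (-1) * (2 * a\<^sup>2 * L * (K + L + 1) / ((K + 1) * (K + 2) * (L + 1)))
      + B (-2) * (a\<^sup>2 * L * (K + L + 1) / ((K + 1)\<^sup>2 * (K + 2)))
    = 2 * a ^ 3 * (K + L + 1)\<^sup>2 * (K + L + 2) / ((K + 1)\<^sup>2 * (K + 2) * ((L + 1)\<^sup>2 * (L + 2)))"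
    unfolding c2 c1 a_def[symmetric] using KL
    by (simp add: divide_simps power2_eq_square power3_eq_cube) (simp add: algebra_simps)
  also have "\<dots> = inverse (K + L + 2) * inverse ((K + L + 2) * (K + L + 1) / 2) *
      (a * (K + L + 1) * (K + L + 2) / ((L + 1) * (L + 2)) *
       (a * (K + L + 1) * (K + L + 2) / ((K + 1) * (L + 1))) *
       (a * (K + L + 1) * (K + L + 2) / ((K + 1) * (K + 2))))"
    using KL by (simp add: divide_simps power2_eq_square power3_eq_cube)
  finally show ?thesis
    unfolding e0 e1 e2 f0 f1 f2 ch using KL by simp
qed

text \<open>At \<open>i = j = 0\<close> the walkers start side by side at \<open>t + 2\<close>,
  \<open>t + 1\<close>, \<open>t\<close>, and each advances \<open>k = - t\<close> times in total,
  so only \<open>k\<close> from 0 to \<open>m\<close> contributes.\<close>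

lemma walks_closed:
  "real (walks m 0 0) =
    inverse (real (m + 2)) * inverse (real ((m + 2) choose 2)) *
    (\<Sum>k=0..m. real ((m + 2) choose k) * real ((m + 2) choose (k + 1)) * real ((m + 2) choose (k + 2)))"
proof -
  let ?D = "\<lambda>t. walker_det m (t + 2) (t + 1) t"
  have "int (walks m 0 0) = (\<Sum>t = - int m - 2..2. ?D t)"
    using walks_eq_sum_walker_det[of m m 0 0] by simp
  also have "\<dots> = (\<Sum>t = - int m..0. ?D t)"
    by (rule sum.mono_neutral_right) (auto intro!: walker_det_eq_0)
  also have "\<dots> = (\<Sum>k=0..m. walker_det m (2 - int k) (1 - int k) (- int k))"
    by (rule sum.reindex_bij_witness[of _ "\<lambda>k. - int k" "\<lambda>t. nat (- t)"]) (auto simp: add.commute)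
  finally have "real_of_int (int (walks m 0 0)) =
      real_of_int (\<Sum>k=0..m. walker_det m (2 - int k) (1 - int k) (- int k))"
    by (rule arg_cong)
  then show ?thesis
    by (simp add: binomial_toeplitz_det sum_distrib_left)
qed

section \<open>Noncrossing matchings and words\<close>

text \<open>
  The pair \<open>(s, t)\<close> stands for an arc from point \<open>s + 1\<close> to point \<open>t + 2\<close>.  With this indexing an arc
  between consecutive points is \<open>(s, s)\<close>.
\<close>

definition noncrossing_matching :: "(nat \<times> nat) set \<Rightarrow> bool" where
  "noncrossing_matching M \<longleftrightarrow>
     (\<forall>(s, t)\<in>M. s \<le> t) \<and>
     (\<forall>(s, t)\<in>M. \<forall>(s', t')\<in>M. (s, t) \<noteq> (s', t') \<longrightarrow>
        s \<noteq> s' \<and> t \<noteq> t' \<and> \<not> (s < s' \<and> s' \<le> t \<and> t < t'))"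

lemma noncrossing_matchingD:
  assumes "noncrossing_matching M" "(s, t) \<in> M"
  shows "s \<le> t"
    and "(s', t') \<in> M \<Longrightarrow> s = s' \<longleftrightarrow> t = t'"
    and "(s', t') \<in> M \<Longrightarrow> s < s' \<Longrightarrow> s' \<le> t \<Longrightarrow> t' < t"
proof -
  show "s \<le> t" using bspec[OF conjunct1[OF assms(1)[unfolded noncrossing_matching_def]] assms(2)] by simp
  have "(s, t) \<noteq> (s', t') \<longrightarrow> s \<noteq> s' \<and> t \<noteq> t' \<and> \<not> (s < s' \<and> s' \<le> t \<and> t < t')" if "(s', t') \<in> M"
    using bspec[OF conjunct2[OF assms(1)[unfolded noncrossing_matching_def]] assms(2)] that by auto
  then show "(s', t') \<in> M \<Longrightarrow> s = s' \<longleftrightarrow> t = t'" "(s', t') \<in> M \<Longrightarrow> s < s' \<Longrightarrow> s' \<le> t \<Longrightarrow> t' < t"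
    by auto
qed

lemma noncrossing_matchingI:
  assumes "\<And>s t. (s, t) \<in> M \<Longrightarrow> s \<le> t"
    and "\<And>s t s' t'. (s, t) \<in> M \<Longrightarrow> (s', t') \<in> M \<Longrightarrow> (s, t) \<noteq> (s', t') \<Longrightarrow>
      s \<noteq> s' \<and> t \<noteq> t' \<and> \<not> (s < s' \<and> s' \<le> t \<and> t < t')"
  shows "noncrossing_matching M"
  unfolding noncrossing_matching_def
proof (intro conjI ballI)
  fix x assume "x \<in> M"
  then show "case x of (s, t) \<Rightarrow> s \<le> t" using assms(1) by (cases x) simp
next
  fix x assume x: "x \<in> M"
  show "case x of (s, t) \<Rightarrow> \<forall>(s', t')\<in>M. (s, t) \<noteq> (s', t') \<longrightarrow>
      s \<noteq> s' \<and> t \<noteq> t' \<and> \<not> (s < s' \<and> s' \<le> t \<and> t < t')"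
    using assms(2) x by (cases x) auto
qed

lemma noncrossing_matching_subset:
  assumes "noncrossing_matching M" "N \<subseteq> M"
  shows "noncrossing_matching N"
proof (rule noncrossing_matchingI)
  show "s \<le> t" if "(s, t) \<in> N" for s t
    using noncrossing_matchingD(1)[OF assms(1)] that assms(2) by auto
  show "s \<noteq> s' \<and> t \<noteq> t' \<and> \<not> (s < s' \<and> s' \<le> t \<and> t < t')"
    if "(s, t) \<in> N" "(s', t') \<in> N" "(s, t) \<noteq> (s', t')" for s t s' t'
  proof -
    have "(s, t) \<in> M" "(s', t') \<in> M" using that assms(2) by auto
    then show ?thesis using noncrossing_matchingD(2,3)[OF assms(1), of s t s' t'] that(3) by auto
  qed
qed

text \<open>\<open>S\<close> holds the lower ends, \<open>T\<close> the upper ends, and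
  \<open>c\<close> arcs are open beforehand. Both counts include position \<open>x\<close> itself,
  because in this indexing \<open>(x, x)\<close> is an arc.\<close>

definition ballot :: "nat \<Rightarrow> nat set \<Rightarrow> nat set \<Rightarrow> bool" where
  "ballot c S T \<longleftrightarrow>
     (\<forall>x. card (T \<inter> {..x}) \<le> c + card (S \<inter> {..x})) \<and> card T = c + card S"

lemma noncrossing_matching_inj:
  assumes "noncrossing_matching M"
  shows "inj_on fst M" "inj_on snd M"
proof -
  show "inj_on fst M" "inj_on snd M"
    using noncrossing_matchingD(2)[OF assms] by (auto intro!: inj_onI)
qed

text \<open>An arc that has ended by \<open>x\<close> has started by \<open>x\<close>; injectivity
  of both projections turns this into an inequality of cardinalities.\<close>

lemma noncrossing_matching_ballot:
  assumes "noncrossing_matching M" "finite M"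
  shows "ballot 0 (fst ` M) (snd ` M)"
proof -
  note inj = noncrossing_matching_inj[OF assms(1)]
  have "card (snd ` M \<inter> {..x}) \<le> card (fst ` M \<inter> {..x})" for x
  proof -
    have "snd ` M \<inter> {..x} = snd ` {a \<in> M. snd a \<le> x}" by auto
    then have "card (snd ` M \<inter> {..x}) = card {a \<in> M. snd a \<le> x}"
      using inj by (simp add: card_image inj_on_subset)
    also have "\<dots> = card (fst ` {a \<in> M. snd a \<le> x})"
      using inj by (subst card_image) (auto intro: inj_on_subset)
    also have "\<dots> \<le> card (fst ` M \<inter> {..x})"
    proof (rule card_mono)
      show "finite (fst ` M \<inter> {..x})" using assms(2) by simp
      show "fst ` {a \<in> M. snd a \<le> x} \<subseteq> fst ` M \<inter> {..x}"
      proof clarify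
        fix s t assume "(s, t) \<in> M" "snd (s, t) \<le> x"
        then show "fst (s, t) \<in> fst ` M \<inter> {..x}"
          using noncrossing_matchingD(1)[OF assms(1), of s t] by (auto intro: image_eqI[of _ _ "(s, t)"])
      qed
    qed
    finally show ?thesis .
  qed
  then show ?thesis unfolding ballot_def using inj by (simp add: card_image)
qed

text \<open>Bracket matching, by induction on the number of upper ends: the pair that closes first
  is forced, and removing it leaves a smaller ballot pair.\<close>

lemma ex1_noncrossing_matching:
  assumes "finite S" "finite T" "ballot 0 S T"
  shows "\<exists>!M. noncrossing_matching M \<and> fst ` M = S \<and> snd ` M = T"
  using assms
proof (induction "card T" arbitrary: S T)
  case 0
  then have "S = {}" "T = {}" by (auto simp: ballot_def)
  then show ?case by (auto simp: noncrossing_matching_def)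
next
  case (Suc n)
  define t where "t = Min T"
  have "T \<noteq> {}" using Suc.hyps(2) by auto
  then have t: "t \<in> T" "\<And>u. u \<in> T \<Longrightarrow> t \<le> u"
    using Suc.prems by (auto simp: t_def)
  have "card (T \<inter> {..t}) > 0" using t Suc.prems by (auto simp: card_gt_0_iff)
  then have "card (S \<inter> {..t}) > 0"
    using Suc.prems(3) unfolding ballot_def by (metis add_0 order_less_le_trans)
  then have ne: "S \<inter> {..t} \<noteq> {}" by auto
  \<comment> \<open>Every noncrossing matching joins the least upper end to the nearest lower end below it.\<close>
  define s where "s = Max (S \<inter> {..t})"
  have s: "s \<in> S" "s \<le> t" "\<And>u. u \<in> S \<Longrightarrow> u \<le> t \<Longrightarrow> u \<le> s"
    using Max_in[OF _ ne] Suc.prems by (auto simp: s_def)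
  have T': "n = card (T - {t})" using Suc.hyps(2) Suc.prems t by simp
  \<comment> \<open>No upper end lies below \<open>t\<close>, and from \<open>t\<close> on both
    counts drop by one.\<close>
  have "ballot 0 (S - {s}) (T - {t})"
    unfolding ballot_def
  proof (intro conjI allI)
    fix x
    show "card ((T - {t}) \<inter> {..x}) \<le> 0 + card ((S - {s}) \<inter> {..x})"
    proof (cases "x < t")
      case True
      then have "u \<notin> (T - {t}) \<inter> {..x}" for u using t(2)[of u] by auto
      then have "(T - {t}) \<inter> {..x} = {}" by blast
      then show ?thesis by simp
    next
      case False
      have "(T - {t}) \<inter> {..x} = T \<inter> {..x} - {t}" "(S - {s}) \<inter> {..x} = S \<inter> {..x} - {s}" by auto
      moreover have "card (T \<inter> {..x}) \<le> card (S \<inter> {..x})"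
        using Suc.prems(3) unfolding ballot_def by (metis add_0)
      moreover have "t \<in> T \<inter> {..x}" "s \<in> S \<inter> {..x}" using False t(1) s(1,2) by auto
      ultimately show ?thesis using Suc.prems(1,2) by (simp add: diff_le_mono)
    qed
    show "card (T - {t}) = 0 + card (S - {s})"
      using Suc.prems t(1) s(1) by (simp add: ballot_def)
  qed
  from Suc.hyps(1)[OF T' _ _ this] Suc.prems obtain M' where
    M': "noncrossing_matching M'" "fst ` M' = S - {s}" "snd ` M' = T - {t}"
    and uniq: "\<And>M. noncrossing_matching M \<Longrightarrow> fst ` M = S - {s} \<Longrightarrow> snd ` M = T - {t} \<Longrightarrow> M = M'"
    by (metis finite_Diff)
  show ?case
  proof (intro ex1I[of _ "insert (s, t) M'"] conjI)
    \<comment> \<open>Hence every remaining arc either encloses \<open>(s, t)\<close> or lies above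
      it, and none crosses it.\<close>
    have out: "s' \<noteq> s \<and> t' \<noteq> t \<and> t < t' \<and> (s' < s \<or> t < s')" if "(s', t') \<in> M'" for s' t'
    proof -
      have "s' \<in> S - {s}" "t' \<in> T - {t}"
        using that M'(2,3) by (metis fst_conv image_eqI, metis snd_conv image_eqI)
      then show ?thesis using s(3)[of s'] t(2)[of t'] by auto
    qed
    show "noncrossing_matching (insert (s, t) M')"
    proof (rule noncrossing_matchingI)
      show "a \<le> b" if "(a, b) \<in> insert (s, t) M'" for a b
        using that s(2) noncrossing_matchingD(1)[OF M'(1), of a b] by auto
      show "a \<noteq> a' \<and> b \<noteq> b' \<and> \<not> (a < a' \<and> a' \<le> b \<and> b < b')"
        if "(a, b) \<in> insert (s, t) M'" "(a', b') \<in> insert (s, t) M'" "(a, b) \<noteq> (a', b')" for a b a' b'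
      proof (cases "(a, b) \<in> M'")
        case True
        then show ?thesis
          using that out[of a b] noncrossing_matchingD(2,3)[OF M'(1) True, of a' b'] by auto
      next
        case False
        then have "a = s" "b = t" "(a', b') \<in> M'" using that by auto
        then show ?thesis using out[of a' b'] by auto
      qed
    qed
    show "fst ` insert (s, t) M' = S" "snd ` insert (s, t) M' = T" using M'(2,3) s(1) t(1) by auto
  next
    fix M assume "noncrossing_matching M \<and> fst ` M = S \<and> snd ` M = T"
    then have M: "noncrossing_matching M" and im: "fst ` M = S" "snd ` M = T" by auto
    obtain p where p: "(p, t) \<in> M" using t(1) unfolding im(2)[symmetric] by auto
    obtain q where q: "(s, q) \<in> M" using s(1) unfolding im(1)[symmetric] by auto
    have "p \<in> S" "q \<in> T" using p q im by (metis fst_conv image_eqI, metis snd_conv image_eqI)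
    then have "p \<le> s" "t \<le> q"
      using s(3) t(2) noncrossing_matchingD(1)[OF M p] by blast+
    \<comment> \<open>If \<open>p < s\<close>, then \<open>(p, t)\<close> and \<open>(s, q)\<close>
      would cross or share their upper end, since \<open>s \<le> t \<le> q\<close>.\<close>
    then have "p = s"
      using noncrossing_matchingD(2,3)[OF M p q] s(2) by (metis le_neq_implies_less leD)
    with p have st: "(s, t) \<in> M" by simp
    have "fst ` (M - {(s, t)}) = S - {s}" "snd ` (M - {(s, t)}) = T - {t}"
      using inj_on_image_set_diff[of fst M M "{(s, t)}"] inj_on_image_set_diff[of snd M M "{(s, t)}"]
        noncrossing_matching_inj[OF M] st im by simp_all
    then have "M - {(s, t)} = M'"
      using noncrossing_matching_subset[OF M, of "M - {(s, t)}"] by (intro uniq) auto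
    then show "M = insert (s, t) M'" using st by auto
  qed
qed

section \<open>Words of letters and their count\<close>

text \<open>
  The letter at position \<open>k\<close> of a word records the side (\<open>True\<close> for left) of the arc starting at point
  \<open>k + 1\<close> and the side of the arc ending at point \<open>k + 2\<close>, if there are such arcs.
\<close>

type_synonym letter = "bool option \<times> bool option"

text \<open>The counter \<open>c\<close> is the number of open arcs on side \<open>b\<close>. The
  start in a letter is counted before the end, since letter \<open>k\<close> starts an arc at point
  \<open>k + 1\<close> and ends one at point \<open>k + 2\<close>.\<close>

fun side_ok :: "bool \<Rightarrow> nat \<Rightarrow> letter list \<Rightarrow> bool" where
  "side_ok b c [] \<longleftrightarrow> c = 0"
| "side_ok b c ((a, e) # w) \<longleftrightarrow>
     (if e = Some b then c + of_bool (a = Some b) > 0 \<and> side_ok b (c + of_bool (a = Some b) - 1) w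
      else side_ok b (c + of_bool (a = Some b)) w)"

definition opens :: "bool \<Rightarrow> letter list \<Rightarrow> nat set" where
  "opens b w = {k. k < length w \<and> fst (w ! k) = Some b}"

definition closes :: "bool \<Rightarrow> letter list \<Rightarrow> nat set" where
  "closes b w = {k. k < length w \<and> snd (w ! k) = Some b}"

lemma finite_opens_closes [simp]: "finite (opens b w)" "finite (closes b w)"
  by (auto simp: opens_def closes_def)

lemma opens_Cons: "opens b (l # w) = (if fst l = Some b then {0} else {}) \<union> Suc ` opens b w"
proof (rule set_eqI)
  show "k \<in> opens b (l # w) \<longleftrightarrow> k \<in> (if fst l = Some b then {0} else {}) \<union> Suc ` opens b w" for k
    by (cases k) (auto simp: opens_def)
qed

lemma closes_Cons: "closes b (l # w) = (if snd l = Some b then {0} else {}) \<union> Suc ` closes b w"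
proof (rule set_eqI)
  show "k \<in> closes b (l # w) \<longleftrightarrow> k \<in> (if snd l = Some b then {0} else {}) \<union> Suc ` closes b w" for k
    by (cases k) (auto simp: closes_def)
qed

lemma card_zero_Suc_image:
  assumes "finite A"
  shows "card ((if P then {0} else {}) \<union> Suc ` A) = of_bool P + card A"
    and "card (((if P then {0} else {}) \<union> Suc ` A) \<inter> {..0}) = of_bool P"
    and "card (((if P then {0} else {}) \<union> Suc ` A) \<inter> {..Suc x}) = of_bool P + card (A \<inter> {..x})"
proof -
  have c: "card ((if P then {0} else {}) \<union> Suc ` B) = of_bool P + card B" if "finite B" for B
    using that by (subst card_Un_disjoint) (auto simp: card_image)
  show "card ((if P then {0} else {}) \<union> Suc ` A) = of_bool P + card A" by (rule c[OF assms])
  have "((if P then {0} else {}) \<union> Suc ` A) \<inter> {..0} = (if P then {0} else {})" by auto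
  then show "card (((if P then {0} else {}) \<union> Suc ` A) \<inter> {..0}) = of_bool P" by simp
  have "((if P then {0} else {}) \<union> Suc ` A) \<inter> {..Suc x} = (if P then {0} else {}) \<union> Suc ` (A \<inter> {..x})"
    by auto
  then show "card (((if P then {0} else {}) \<union> Suc ` A) \<inter> {..Suc x}) = of_bool P + card (A \<inter> {..x})"
    using c[of "A \<inter> {..x}"] assms by simp
qed

lemma all_nat_split: "(\<forall>x. P x) \<longleftrightarrow> P 0 \<and> (\<forall>x. P (Suc x))"
  by (metis not0_implies_Suc)

text \<open>Removing the first letter shifts positions by one and updates \<open>c\<close>: the
  ballot inequality at 0 becomes the guard of \<open>side_ok\<close>, and those at
  \<open>Suc x\<close> become the ballot condition of the tail.\<close>

lemma side_ok_iff_ballot: "side_ok b c w \<longleftrightarrow> ballot c (opens b w) (closes b w)"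
proof (induction w arbitrary: c)
  case Nil
  then show ?case by (auto simp: ballot_def opens_def closes_def)
next
  case (Cons l w)
  obtain a e where l: "l = (a, e)" by (cases l)
  define P where "P x \<longleftrightarrow> card (closes b (l # w) \<inter> {..x}) \<le> c + card (opens b (l # w) \<inter> {..x})" for x
  have "ballot c (opens b (l # w)) (closes b (l # w)) \<longleftrightarrow> P 0 \<and> (\<forall>x. P (Suc x)) \<and>
     card (closes b (l # w)) = c + card (opens b (l # w))"
    unfolding ballot_def using all_nat_split[of P] by (simp add: P_def)
  also have "\<dots> \<longleftrightarrow> of_bool (e = Some b) \<le> c + of_bool (a = Some b) \<and>
      (\<forall>x. of_bool (e = Some b) + card (closes b w \<inter> {..x}) \<le> c + of_bool (a = Some b) + card (opens b w \<inter> {..x})) \<and>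
      of_bool (e = Some b) + card (closes b w) = c + of_bool (a = Some b) + card (opens b w)"
    unfolding P_def opens_Cons closes_Cons by (simp add: card_zero_Suc_image l add.assoc)
  also have "\<dots> \<longleftrightarrow> side_ok b c (l # w)"
  proof (cases "e = Some b")
    case True
    show ?thesis
    proof (cases "c + of_bool (a = Some b)")
      case 0
      then show ?thesis using True by (simp add: l)
    next
      case (Suc d)
      then show ?thesis using True by (simp add: l Cons ballot_def)
    qed
  next
    case False
    then show ?thesis by (simp add: l Cons ballot_def)
  qed
  finally show ?case by simp
qed

text \<open>At the start \<open>i\<close> left and \<open>j\<close> right arcs are open. The
  excluded letter would force a right arc between consecutive points, which is recorded as a left
  arc instead.\<close>

definition words :: "nat \<Rightarrow> nat \<Rightarrow> nat \<Rightarrow> letter list set" where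
  "words m i j = {w. length w = m \<and> (Some False, Some False) \<notin> set w \<and> side_ok True i w \<and> side_ok False j w}"

lemma finite_words: "finite (words m i j)"
  by (rule finite_subset[OF _ finite_lists_length_eq[of "UNIV :: letter set" m]]) (auto simp: words_def)

lemma UNIV_letter: "(UNIV :: letter set) =
   {(None, None), (None, Some True), (None, Some False), (Some True, None), (Some True, Some True),
    (Some True, Some False), (Some False, None), (Some False, Some True), (Some False, Some False)}"
proof (rule UNIV_eq_I)
  fix x :: letter
  obtain a b where x: "x = (a, b)" by (cases x)
  have "a = None \<or> a = Some True \<or> a = Some False" "b = None \<or> b = Some True \<or> b = Some False"
    by (cases a; auto) (cases b; auto)
  then show "x \<in> {(None, None), (None, Some True), (None, Some False), (Some True, None), (Some True, Some True),
    (Some True, Some False), (Some False, None), (Some False, Some True), (Some False, Some False)}"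
    unfolding x by (elim disjE) simp_all
qed

text \<open>The eight admissible first letters are the eight steps of \<open>walks\<close>: starting
  or ending an arc changes \<open>i\<close> (left) or \<open>j\<close> (right) by one. The letters
  \<open>(None, None)\<close> and \<open>(Some True, Some True)\<close> change neither, whence the
  factor 2.\<close>

lemma card_words: "card (words m i j) = walks m i j"
proof (induction m arbitrary: i j)
  case 0
  have "words 0 i j = (if i = 0 \<and> j = 0 then {[]} else {})" by (auto simp: words_def)
  then show ?case by simp
next
  case (Suc m)
  define N where "N l = {w. l # w \<in> words (Suc m) i j}" for l
  have "words (Suc m) i j = (\<Union>l. (#) l ` N l)"
  proof -
    have "w \<in> words (Suc m) i j \<longleftrightarrow> w \<in> (\<Union>l. (#) l ` N l)" for w
    proof (cases w)
      case Nil
      then show ?thesis by (auto simp: words_def)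
    next
      case (Cons l v)
      then show ?thesis by (auto simp: N_def image_iff simp del: split_paired_Ex)
    qed
    then show ?thesis by blast
  qed
  moreover have fin: "finite (N l)" for l
  proof -
    have "finite ((#) l ` N l)"
      by (rule finite_subset[OF _ finite_words[of "Suc m" i j]]) (auto simp: N_def)
    then show ?thesis by (simp add: finite_image_iff)
  qed
  ultimately have "card (words (Suc m) i j) = (\<Sum>l\<in>UNIV. card ((#) l ` N l))"
    by (subst card_UN_disjoint[symmetric]) auto
  also have "\<dots> = (\<Sum>l\<in>UNIV. card (N l))" by (simp add: card_image inj_on_def)
  also have "\<dots> = walks (Suc m) i j"
  proof -
    have *: "N (Some False, Some False) = {}" by (auto simp: N_def words_def)
    have N: "N (None, None) = words m i j"
      "N (None, Some True) = (if i = 0 then {} else words m (i - 1) j)"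
      "N (None, Some False) = (if j = 0 then {} else words m i (j - 1))"
      "N (Some True, None) = words m (Suc i) j"
      "N (Some True, Some True) = words m i j"
      "N (Some True, Some False) = (if j = 0 then {} else words m (Suc i) (j - 1))"
      "N (Some False, None) = words m i (Suc j)"
      "N (Some False, Some True) = (if i = 0 then {} else words m (i - 1) (Suc j))"
      by (auto simp: N_def words_def)
    show ?thesis unfolding UNIV_letter by (simp add: * N Suc)
  qed
  finally show ?case .
qed

text \<open>
  An arc between consecutive points is both a left and a right arc; it is recorded as a left arc only.
\<close>

definition arc_pairs :: "nat \<Rightarrow> ((nat \<times> nat) set \<times> (nat \<times> nat) set) set" where
  "arc_pairs m = {(L, R). L \<subseteq> {..<m} \<times> {..<m} \<and> R \<subseteq> {..<m} \<times> {..<m} \<and>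
     noncrossing_matching L \<and> noncrossing_matching R \<and>
     fst ` L \<inter> fst ` R = {} \<and> snd ` L \<inter> snd ` R = {} \<and> (\<forall>k. (k, k) \<notin> R)}"

definition word_of :: "nat \<Rightarrow> (nat \<times> nat) set \<times> (nat \<times> nat) set \<Rightarrow> letter list" where
  "word_of m = (\<lambda>(L, R). map (\<lambda>k.
     (if k \<in> fst ` L then Some True else if k \<in> fst ` R then Some False else None,
      if k \<in> snd ` L then Some True else if k \<in> snd ` R then Some False else None)) [0..<m])"

text \<open>Disjointness of the lower ends, and of the upper ends, ensures that testing
  \<open>L\<close> first loses nothing of \<open>R\<close>.\<close>

lemma opens_closes_word_of:
  assumes "(L, R) \<in> arc_pairs m"
  shows "opens True (word_of m (L, R)) = fst ` L" "opens False (word_of m (L, R)) = fst ` R"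
    "closes True (word_of m (L, R)) = snd ` L" "closes False (word_of m (L, R)) = snd ` R"
proof -
  have d: "\<And>k. k \<in> fst ` R \<Longrightarrow> k \<notin> fst ` L" "\<And>k. k \<in> snd ` R \<Longrightarrow> k \<notin> snd ` L"
    using assms unfolding arc_pairs_def disjoint_iff by simp_all metis+
  have "L \<subseteq> {..<m} \<times> {..<m}" "R \<subseteq> {..<m} \<times> {..<m}"
    using assms by (simp_all add: arc_pairs_def)
  then have b: "\<And>k. k \<in> fst ` L \<Longrightarrow> k < m" "\<And>k. k \<in> fst ` R \<Longrightarrow> k < m"
    "\<And>k. k \<in> snd ` L \<Longrightarrow> k < m" "\<And>k. k \<in> snd ` R \<Longrightarrow> k < m"
    by auto
  have n: "length (word_of m (L, R)) = m"
    "\<And>k. k < m \<Longrightarrow> word_of m (L, R) ! k =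
     (if k \<in> fst ` L then Some True else if k \<in> fst ` R then Some False else None,
      if k \<in> snd ` L then Some True else if k \<in> snd ` R then Some False else None)"
    by (simp_all add: word_of_def)
  have mem: "k \<in> opens c (word_of m (L, R)) \<longleftrightarrow> k < m \<and> (if c then k \<in> fst ` L else k \<in> fst ` R)"
    "k \<in> closes c (word_of m (L, R)) \<longleftrightarrow> k < m \<and> (if c then k \<in> snd ` L else k \<in> snd ` R)" for k c
  proof -
    have "(if p then Some True else if q then Some False else None) = Some c \<longleftrightarrow> (if c then p else q)"
      if "q \<Longrightarrow> \<not> p" for p q
      using that by (cases p; cases q; cases c) simp_all
    from this[OF d(1)] this[OF d(2)]
    show "k \<in> opens c (word_of m (L, R)) \<longleftrightarrow> k < m \<and> (if c then k \<in> fst ` L else k \<in> fst ` R)"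
      "k \<in> closes c (word_of m (L, R)) \<longleftrightarrow> k < m \<and> (if c then k \<in> snd ` L else k \<in> snd ` R)"
      unfolding opens_def closes_def mem_Collect_eq n(1) by (simp_all only: n(2) fst_conv snd_conv cong: conj_cong)
  qed
  show "opens True (word_of m (L, R)) = fst ` L"
    using b unfolding set_eq_iff mem(1) by (simp only: if_True if_False) metis
  show "opens False (word_of m (L, R)) = fst ` R"
    using b unfolding set_eq_iff mem(1) by (simp only: if_True if_False) metis
  show "closes True (word_of m (L, R)) = snd ` L"
    using b unfolding set_eq_iff mem(2) by (simp only: if_True if_False) metis
  show "closes False (word_of m (L, R)) = snd ` R"
    using b unfolding set_eq_iff mem(2) by (simp only: if_True if_False) metis
qed

text \<open>A word fixes the sets of lower and upper ends on each side, and by the ballot criterion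
  these belong to exactly one noncrossing matching per side.\<close>

lemma card_arc_pairs: "card (arc_pairs m) = walks m 0 0"
proof -
  have "bij_betw (word_of m) (arc_pairs m) (words m 0 0)"
    unfolding bij_betw_def
  proof (intro conjI equalityI subsetI)
    have fin: "finite L \<and> finite R" if "(L, R) \<in> arc_pairs m" for L R
      using that unfolding arc_pairs_def by (auto intro: finite_subset[of _ "{..<m} \<times> {..<m}"])
    show "inj_on (word_of m) (arc_pairs m)"
    proof (rule inj_onI, clarify)
      fix L R L' R' assume a: "(L, R) \<in> arc_pairs m" "(L', R') \<in> arc_pairs m"
        and eq: "word_of m (L, R) = word_of m (L', R')"
      have e: "fst ` L = fst ` L'" "snd ` L = snd ` L'" "fst ` R = fst ` R'" "snd ` R = snd ` R'"
        using opens_closes_word_of[OF a(1)] opens_closes_word_of[OF a(2)] eq by simp_all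
      have u: "M = M'" if "noncrossing_matching M" "noncrossing_matching M'" "finite M"
        "fst ` M = fst ` M'" "snd ` M = snd ` M'" for M M'
        using ex1_noncrossing_matching[OF _ _ noncrossing_matching_ballot[OF that(1,3)]] that
        by (metis finite_imageI)
      show "L = L' \<and> R = R'"
        using a e fin[OF a(1)] u[of L L'] u[of R R'] by (simp add: arc_pairs_def)
    qed
    {
      fix w assume "w \<in> word_of m ` arc_pairs m"
      then obtain L R where LR: "(L, R) \<in> arc_pairs m" and w: "w = word_of m (L, R)" by auto
      have ncm: "noncrossing_matching L" "noncrossing_matching R" using LR by (auto simp: arc_pairs_def)
      have "(Some False, Some False) \<notin> set w"
      proof
        assume "(Some False, Some False) \<in> set w"
        then obtain k where "k \<in> opens False w" "k \<in> closes False w"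
          by (auto simp: in_set_conv_nth opens_def closes_def) (metis fst_conv snd_conv)
        then obtain s t where st: "(k, t) \<in> R" "(s, k) \<in> R"
          using opens_closes_word_of[OF LR] w by auto
        \<comment> \<open>If \<open>s < k\<close>, the arcs \<open>(s, k)\<close> and
          \<open>(k, t)\<close> would cross, as point \<open>k + 1\<close> lies below point
          \<open>k + 2\<close>. Then \<open>s = k\<close> puts \<open>(k, k)\<close> into
          \<open>R\<close>, which is excluded.\<close>
        then have "s = k"
          using noncrossing_matchingD(1)[OF ncm(2) st(2)] noncrossing_matchingD(1)[OF ncm(2) st(1)]
            noncrossing_matchingD(3)[OF ncm(2) st(2,1)] by (cases "s < k") auto
        then show False using st LR by (auto simp: arc_pairs_def)
      qed
      moreover have "length w = m" by (simp add: w word_of_def)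
      ultimately show "w \<in> words m 0 0"
        using noncrossing_matching_ballot ncm fin[OF LR] opens_closes_word_of[OF LR]
        by (simp add: words_def side_ok_iff_ballot w)
    next
      fix w assume w: "w \<in> words m 0 0"
      then have "ballot 0 (opens b w) (closes b w)" for b
        using side_ok_iff_ballot[of b 0 w] by (cases b) (auto simp: words_def)
      then have "\<exists>M. noncrossing_matching M \<and> fst ` M = opens b w \<and> snd ` M = closes b w" for b
        using ex1_noncrossing_matching[of "opens b w" "closes b w"] by auto
      then obtain M where M: "\<And>b. noncrossing_matching (M b)" "\<And>b. fst ` M b = opens b w"
        "\<And>b. snd ` M b = closes b w" by metis
      have len: "length w = m" using w by (simp add: words_def)
      have sub: "M b \<subseteq> {..<m} \<times> {..<m}" for b
      proof clarify
        fix s t assume "(s, t) \<in> M b"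
        then have "s \<in> opens b w" "t \<in> closes b w" using M(2,3)[of b] by force+
        then show "s \<in> {..<m} \<and> t \<in> {..<m}" by (auto simp: opens_def closes_def len)
      qed
      have "(k, k) \<notin> M False" for k
      proof
        assume "(k, k) \<in> M False"
        then have "k \<in> opens False w" "k \<in> closes False w" using M(2,3)[of False] by force+
        then have "w ! k = (Some False, Some False)" "k < length w"
          by (auto simp: opens_def closes_def prod_eq_iff)
        then show False using w by (auto simp: words_def in_set_conv_nth)
      qed
      moreover have "opens True w \<inter> opens False w = {}" "closes True w \<inter> closes False w = {}"
        by (auto simp: opens_def closes_def)
      ultimately have mem: "(M True, M False) \<in> arc_pairs m"
        using M sub unfolding arc_pairs_def by simp
      have "word_of m (M True, M False) = w"
      proof (rule nth_equalityI)
        show "length (word_of m (M True, M False)) = length w" by (simp add: word_of_def len)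
        fix k assume "k < length (word_of m (M True, M False))"
        then have k: "k < m" by (simp add: word_of_def)
        have x: "x = None \<or> x = Some True \<or> x = Some False" for x :: "bool option" by (cases x) auto
        show "word_of m (M True, M False) ! k = w ! k"
          using k x[of "fst (w ! k)"] x[of "snd (w ! k)"]
          by (auto simp: word_of_def M opens_def closes_def len prod_eq_iff)
      qed
      then show "w \<in> word_of m ` arc_pairs m" using mem by (metis imageI)
    }
  qed
  then have "card (arc_pairs m) = card (words m 0 0)" by (rule bij_betw_same_card)
  then show ?thesis by (simp add: card_words)
qed

section \<open>Drawn arcs\<close>

abbreviation pt :: "nat \<Rightarrow> real \<times> real" where
  "pt i \<equiv> (0, real i)"

lemma mem_points_iff: "v \<in> points n \<longleftrightarrow> (\<exists>i. 1 \<le> i \<and> i \<le> n \<and> v = pt i)"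
  by (auto simp: points_def)

text \<open>Forgets the parametrisation: \<open>g\<close> is the horizontal coordinate as a function
  of height. Sides become signs of \<open>g\<close> at integers, and crossings become zeros of
  differences.\<close>

definition height_graph :: "(real \<Rightarrow> real \<times> real) \<Rightarrow> nat \<Rightarrow> nat \<Rightarrow> (real \<Rightarrow> real) \<Rightarrow> bool" where
  "height_graph \<gamma> p q g \<longleftrightarrow> p < q \<and> pathstart \<gamma> = pt p \<and> pathfinish \<gamma> = pt q \<and>
     continuous_on {real p..real q} g \<and> path_image \<gamma> = (\<lambda>h. (g h, h)) ` {real p..real q} \<and>
     g (real p) = 0 \<and> g (real q) = 0 \<and> (\<forall>i. p < i \<and> i < q \<longrightarrow> g (real i) \<noteq> 0)"

text \<open>By compactness of the unit interval, a continuous strictly increasing height has a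
  continuous inverse; composing the horizontal coordinate with it gives \<open>g\<close>.\<close>

lemma drawn_arc_height_graph:
  assumes "drawn_arc n \<gamma>"
  obtains p q g where "1 \<le> p" "q \<le> n" "height_graph \<gamma> p q g"
proof -
  define f where "f = (\<lambda>t. snd (\<gamma> t))"
  have path: "continuous_on {0..1} \<gamma>" and mono: "strict_mono_on {0..1} f"
    and avoid: "\<And>t. 0 < t \<Longrightarrow> t < 1 \<Longrightarrow> \<gamma> t \<notin> points n"
    using assms by (auto simp: drawn_arc_def path_def f_def)
  obtain p q where pq: "1 \<le> p" "q \<le> n" "p \<le> n" "\<gamma> 0 = pt p" "\<gamma> 1 = pt q"
    using assms by (auto simp: drawn_arc_def mem_points_iff pathstart_def pathfinish_def)
  have f01: "f 0 = real p" "f 1 = real q" by (simp_all add: f_def pq)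
  have contf: "continuous_on {0..1} f" unfolding f_def by (intro continuous_intros path)
  have inj: "inj_on f {0..1}" using mono by (rule strict_mono_on_imp_inj_on)
  have less: "p < q" using strict_mono_onD[OF mono, of 0 1] f01 by simp
  have le: "f x \<le> f y" if "0 \<le> x" "x \<le> y" "y \<le> 1" for x y
    using strict_mono_onD[OF mono, of x y] that by (cases "x = y") auto
  have im: "f ` {0..1} = {real p..real q}"
  proof (intro equalityI subsetI)
    fix y assume "y \<in> f ` {0..1}"
    then show "y \<in> {real p..real q}" using le[of 0] le[of _ 1] f01 by auto
  next
    fix y assume "y \<in> {real p..real q}"
    then show "y \<in> f ` {0..1}" using IVT'[of f 0 y 1] f01 contf by fastforce
  qed
  define k where "k = the_inv_into {0..1} f"
  have kf: "k (f t) = t" if "t \<in> {0..1}" for t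
    unfolding k_def using inj that by (rule the_inv_into_f_f)
  have contk: "continuous_on {real p..real q} k"
    unfolding im[symmetric] using contf kf by (intro continuous_on_inv) auto
  have kim: "k ` {real p..real q} \<subseteq> {0..1}" unfolding im[symmetric] using kf by auto
  define g where "g h = fst (\<gamma> (k h))" for h
  have g\<gamma>: "(g (f t), f t) = \<gamma> t" if "t \<in> {0..1}" for t
    using kf[OF that] by (simp add: g_def f_def)
  have "continuous_on {real p..real q} g"
    unfolding g_def by (intro continuous_intros continuous_on_compose2[OF path contk kim])
  moreover have "path_image \<gamma> = (\<lambda>h. (g h, h)) ` {real p..real q}"
    unfolding im[symmetric] image_image path_image_def using g\<gamma> by (intro image_cong) auto
  moreover have "g (real p) = 0" "g (real q) = 0"
    using g\<gamma>[of 0] g\<gamma>[of 1] f01 pq by simp_all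
  moreover have "g (real i) \<noteq> 0" if i: "p < i" "i < q" for i
  proof
    assume 0: "g (real i) = 0"
    have "real i \<in> f ` {0..1}" unfolding im using i by auto
    then obtain t where t: "t \<in> {0..1}" "f t = real i" by auto
    moreover have "t \<noteq> 0" "t \<noteq> 1" using t i f01 by auto
    moreover have "\<gamma> t = pt i" using g\<gamma>[OF t(1)] t(2) 0 by simp
    ultimately show False using avoid[of t] i pq by (auto simp: mem_points_iff)
  qed
  ultimately have "height_graph \<gamma> p q g"
    using pq less by (simp add: height_graph_def pathstart_def pathfinish_def)
  with pq show ?thesis using that by blast
qed

lemma height_graph_passes:
  assumes "height_graph \<gamma> p q g"
  shows "passes_left_of \<gamma> (pt i) \<longleftrightarrow> p < i \<and> i < q \<and> g (real i) < 0"
    and "passes_right_of \<gamma> (pt i) \<longleftrightarrow> p < i \<and> i < q \<and> 0 < g (real i)"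
proof -
  have *: "p < i \<and> i < q" if "p \<le> i" "i \<le> q" "g (real i) \<noteq> 0"
  proof -
    have "g (real p) = 0" "g (real q) = 0" using assms by (simp_all add: height_graph_def)
    then have "i \<noteq> p" "i \<noteq> q" using that by auto
    then show ?thesis using that by simp
  qed
  have im: "path_image \<gamma> = (\<lambda>h. (g h, h)) ` {real p..real q}" using assms by (simp add: height_graph_def)
  show "passes_left_of \<gamma> (pt i) \<longleftrightarrow> p < i \<and> i < q \<and> g (real i) < 0"
    and "passes_right_of \<gamma> (pt i) \<longleftrightarrow> p < i \<and> i < q \<and> 0 < g (real i)"
    unfolding passes_left_of_def passes_right_of_def im using * by auto
qed

text \<open>\<open>g\<close> does not vanish at interior integers, so failing to be positive there
  means being negative.\<close>

lemma height_graph_left_arc: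
  assumes "height_graph \<gamma> p q g" "1 \<le> p" "q \<le> n"
  shows "left_arc n \<gamma> \<longleftrightarrow> (\<forall>i. p < i \<and> i < q \<longrightarrow> g (real i) < 0)"
proof -
  have nz: "\<And>i. p < i \<Longrightarrow> i < q \<Longrightarrow> g (real i) \<noteq> 0" using assms(1) by (simp add: height_graph_def)
  have in_range: "1 \<le> i \<and> i \<le> n \<and> (0 < g (real i) \<longleftrightarrow> \<not> g (real i) < 0)" if "p < i" "i < q" for i
    using nz[OF that] that assms(2,3) by auto
  have "left_arc n \<gamma> \<longleftrightarrow> (\<forall>i. 1 \<le> i \<and> i \<le> n \<longrightarrow> \<not> (p < i \<and> i < q \<and> 0 < g (real i)))"
    unfolding left_arc_def height_graph_passes(2)[OF assms(1), symmetric]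
    by (auto simp: points_def)
  also have "\<dots> \<longleftrightarrow> (\<forall>i. p < i \<and> i < q \<longrightarrow> g (real i) < 0)"
    using in_range by blast
  finally show ?thesis .
qed

lemma height_graph_right_arc:
  assumes "height_graph \<gamma> p q g" "1 \<le> p" "q \<le> n"
  shows "right_arc n \<gamma> \<longleftrightarrow> (\<forall>i. p < i \<and> i < q \<longrightarrow> 0 < g (real i))"
proof -
  have nz: "\<And>i. p < i \<Longrightarrow> i < q \<Longrightarrow> g (real i) \<noteq> 0" using assms(1) by (simp add: height_graph_def)
  have in_range: "1 \<le> i \<and> i \<le> n \<and> (0 < g (real i) \<longleftrightarrow> \<not> g (real i) < 0)" if "p < i" "i < q" for i
    using nz[OF that] that assms(2,3) by auto
  have "right_arc n \<gamma> \<longleftrightarrow> (\<forall>i. 1 \<le> i \<and> i \<le> n \<longrightarrow> \<not> (p < i \<and> i < q \<and> g (real i) < 0))"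
    unfolding right_arc_def height_graph_passes(1)[OF assms(1), symmetric]
    by (auto simp: points_def)
  also have "\<dots> \<longleftrightarrow> (\<forall>i. p < i \<and> i < q \<longrightarrow> 0 < g (real i))"
    using in_range by blast
  finally show ?thesis .
qed

lemma arc_class_left_arc:
  assumes "height_graph \<gamma> p q g" "left_arc n \<gamma>"
  shows "arc_class n \<gamma> = (pt p, pt q, {})"
  using assms by (auto simp: arc_class_def height_graph_def left_arc_def)

lemma arc_class_right_arc:
  assumes "height_graph \<gamma> p q g" "1 \<le> p" "q \<le> n" "right_arc n \<gamma>"
  shows "arc_class n \<gamma> = (pt p, pt q, pt ` {p<..<q})"
proof -
  have "0 < g (real i)" if "p < i" "i < q" for i
    using assms height_graph_right_arc[OF assms(1-3)] that by blast
  then have "v \<in> points n \<and> passes_right_of \<gamma> v \<longleftrightarrow> v \<in> pt ` {p<..<q}" for v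
    using height_graph_passes(2)[OF assms(1)] assms(2,3) by (auto simp: mem_points_iff)
  then show ?thesis using assms(1) by (auto simp: arc_class_def height_graph_def)
qed

text \<open>The difference \<open>g - g'\<close> equals \<open>g\<close> at \<open>p'\<close> and
  \<open>- g'\<close> at \<open>q\<close>, two values of opposite sign, so the intermediate value
  theorem gives a common point. As \<open>p < p' < q < q'\<close>, the arcs share no
  endpoint.\<close>

lemma interleaved_height_graphs_meet:
  assumes \<gamma>: "height_graph \<gamma> p q g" and \<delta>: "height_graph \<delta> p' q' g'"
    and less: "p < p'" "p' < q" "q < q'"
    and sign: "g (real p') * g' (real q) > 0"
  shows "\<not> path_image \<gamma> \<inter> path_image \<delta> \<subseteq> {pathstart \<gamma>, pathfinish \<gamma>} \<inter> {pathstart \<delta>, pathfinish \<delta>}"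
proof -
  define d where "d h = g h - g' h" for h
  have "continuous_on {real p'..real q} g" "continuous_on {real p'..real q} g'"
    using \<gamma> \<delta> less unfolding height_graph_def by (auto elim!: continuous_on_subset)
  then have cont: "continuous_on {real p'..real q} d"
    unfolding d_def by (intro continuous_intros)
  have ends: "d (real p') = g (real p')" "d (real q) = - g' (real q)"
    using \<gamma> \<delta> by (simp_all add: d_def height_graph_def)
  have "\<exists>h\<ge>real p'. h \<le> real q \<and> d h = 0"
  proof (cases "g (real p') > 0")
    case True
    then have "g' (real q) > 0" using sign by (simp add: zero_less_mult_iff)
    then show ?thesis using IVT2'[of d "real q" 0 "real p'"] ends cont True less by simp
  next
    case False
    then have "g' (real q) < 0" "g (real p') < 0" using sign by (auto simp: zero_less_mult_iff)
    then show ?thesis using IVT'[of d "real p'" 0 "real q"] ends cont less by simp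
  qed
  then obtain h where h: "real p' \<le> h" "h \<le> real q" "g h = g' h" by (auto simp: d_def)
  have "(g h, h) \<in> path_image \<gamma>" "(g h, h) \<in> path_image \<delta>"
    using \<gamma> \<delta> h less unfolding height_graph_def by (simp_all add: h(3) image_iff)
  moreover have "(g h, h) \<notin> {pathstart \<gamma>, pathfinish \<gamma>} \<inter> {pathstart \<delta>, pathfinish \<delta>}"
    using \<gamma> \<delta> less by (auto simp: height_graph_def)
  ultimately show ?thesis by blast
qed

section \<open>Drawing arcs as parabolas\<close>

text \<open>The sign of \<open>\<sigma>\<close> chooses the side. The leading coefficient does not
  depend on \<open>p\<close> and \<open>q\<close>; this is why nested intervals give nested
  curves.\<close>

definition parabola :: "real \<Rightarrow> nat \<Rightarrow> nat \<Rightarrow> real \<Rightarrow> real \<times> real" where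
  "parabola \<sigma> p q = (\<lambda>t. (\<lambda>h. (\<sigma> * (h - real p) * (real q - h), h)) (real p + t * (real q - real p)))"

lemma height_graph_parabola:
  assumes "p < q" "\<sigma> \<noteq> 0"
  shows "height_graph (parabola \<sigma> p q) p q (\<lambda>h. \<sigma> * (h - real p) * (real q - h))"
proof -
  have "{real p..real q} = (\<lambda>t. real p + t * (real q - real p)) ` {0..1}"
    using assms image_affinity_atLeastAtMost[of "real q - real p" "real p" 0 1]
    by (simp add: mult.commute add.commute)
  then have im: "path_image (parabola \<sigma> p q) = (\<lambda>h. (\<sigma> * (h - real p) * (real q - h), h)) ` {real p..real q}"
    unfolding path_image_def parabola_def by (simp only: image_image)
  have cont: "continuous_on {real p..real q} (\<lambda>h. \<sigma> * (h - real p) * (real q - h))"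
    by (intro continuous_intros)
  show ?thesis
    unfolding height_graph_def using assms
    by (intro conjI im cont) (simp_all add: parabola_def pathstart_def pathfinish_def)
qed

lemma drawn_arc_parabola:
  assumes "1 \<le> p" "p < q" "q \<le> n" "\<sigma> \<noteq> 0"
  shows "drawn_arc n (parabola \<sigma> p q)"
  unfolding drawn_arc_def
proof (intro conjI ballI)
  show "path (parabola \<sigma> p q)" unfolding path_def parabola_def by (intro continuous_intros)
  show "strict_mono_on {0..1} (\<lambda>t. snd (parabola \<sigma> p q t))"
    using assms by (auto simp: strict_mono_on_def parabola_def)
  show "pathstart (parabola \<sigma> p q) \<in> points n" "pathfinish (parabola \<sigma> p q) \<in> points n"
    using assms by (auto simp: parabola_def pathstart_def pathfinish_def mem_points_iff)
  fix t :: real assume t: "t \<in> {0<..<1}"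
  have "fst (parabola \<sigma> p q t) = \<sigma> * (t * (real q - real p)) * ((1 - t) * (real q - real p))"
    by (simp add: parabola_def algebra_simps)
  then have "fst (parabola \<sigma> p q t) \<noteq> 0" using t assms by simp
  then show "parabola \<sigma> p q t \<notin> points n" by (auto simp: mem_points_iff)
qed

lemma left_arc_parabola:
  assumes "1 \<le> p" "p < q" "q \<le> n"
  shows "left_arc n (parabola (-1) p q)"
  using height_graph_left_arc[OF height_graph_parabola[of p q "-1"], of n] assms by (simp add: mult_less_0_iff)

lemma right_arc_parabola:
  assumes "1 \<le> p" "p < q" "q \<le> n"
  shows "right_arc n (parabola 1 p q)"
  using height_graph_right_arc[OF height_graph_parabola[of p q "1"], of n] assms by simp

text \<open>If \<open>a' < b\<close>, the hypotheses force \<open>b' < b\<close>, so both factors on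
  the right are strictly smaller and equality is impossible. Otherwise the intervals meet only end
  to end.\<close>

lemma nested_intervals_parabola_eq:
  fixes a b a' b' h :: real
  assumes "a \<le> h" "h \<le> b" "a' \<le> h" "h \<le> b'" "a < a'" "b \<noteq> b'" "\<not> (a' < b \<and> b < b')"
    and eq: "(h - a) * (b - h) = (h - a') * (b' - h)"
  shows "h = b \<and> h = a'"
proof (cases "a' < b")
  case True
  then have "(h - a') * (b' - h) < (h - a) * (b - h)"
    using assms by (intro mult_strict_mono') auto
  then show ?thesis using eq by simp
qed (use assms in auto)

text \<open>On opposite sides, equal horizontal coordinates have opposite signs and so are 0. On the
  same side, the intervals are nested or do not overlap, and the comparison of products above
  applies.\<close>

lemma parabolas_disjoint:
  assumes "p < q" "p' < q'" "p \<noteq> p'" "q \<noteq> q'" "\<sigma> \<in> {-1, 1}" "\<sigma>' \<in> {-1, 1}"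
    and nc: "\<sigma> = \<sigma>' \<Longrightarrow> \<not> (p < p' \<and> p' < q \<and> q < q') \<and> \<not> (p' < p \<and> p < q' \<and> q' < q)"
  shows "path_image (parabola \<sigma> p q) \<inter> path_image (parabola \<sigma>' p' q') \<subseteq> {pt p, pt q} \<inter> {pt p', pt q'}"
proof
  fix z assume z: "z \<in> path_image (parabola \<sigma> p q) \<inter> path_image (parabola \<sigma>' p' q')"
  have "path_image (parabola \<sigma> p q) = (\<lambda>h. (\<sigma> * (h - real p) * (real q - h), h)) ` {real p..real q}"
    "path_image (parabola \<sigma>' p' q') = (\<lambda>h. (\<sigma>' * (h - real p') * (real q' - h), h)) ` {real p'..real q'}"
    using height_graph_parabola[of p q \<sigma>] height_graph_parabola[of p' q' \<sigma>'] assms(1,2,5,6)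
    by (auto simp: height_graph_def)
  with z obtain h where h: "real p \<le> h" "h \<le> real q" "real p' \<le> h" "h \<le> real q'"
    and zh: "z = (\<sigma> * (h - real p) * (real q - h), h)"
    and eq: "\<sigma> * ((h - real p) * (real q - h)) = \<sigma>' * ((h - real p') * (real q' - h))"
    by (auto simp: mult.assoc)
  have nonneg: "0 \<le> (h - real p) * (real q - h)" "0 \<le> (h - real p') * (real q' - h)"
    using h by simp_all
  have "(h = real p \<or> h = real q) \<and> (h = real p' \<or> h = real q')"
  proof (cases "\<sigma> = \<sigma>'")
    case True
    then have e: "(h - real p) * (real q - h) = (h - real p') * (real q' - h)"
      using eq assms(5) by auto
    show ?thesis
    proof (cases "p < p'")
      case less: True
      then show ?thesis
        using nested_intervals_parabola_eq[OF h _ _ _ e] nc[OF True] assms(4) by auto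
    next
      case False
      then show ?thesis
        using nested_intervals_parabola_eq[OF h(3,4,1,2) _ _ _ e[symmetric]] nc[OF True] assms(3,4) by auto
    qed
  next
    case False
    then have "(h - real p) * (real q - h) = - ((h - real p') * (real q' - h))"
      using eq assms(5,6) by auto
    then have "(h - real p) * (real q - h) = 0" "(h - real p') * (real q' - h) = 0"
      using nonneg by linarith+
    then show ?thesis by auto
  qed
  then show "z \<in> {pt p, pt q} \<inter> {pt p', pt q'}" using zh by auto
qed

section \<open>Equivalence classes of left and right arcs\<close>

definition left_class :: "nat \<times> nat \<Rightarrow> (real \<times> real) \<times> (real \<times> real) \<times> (real \<times> real) set" where
  "left_class = (\<lambda>(s, t). (pt (s + 1), pt (t + 2), {}))"

definition right_class :: "nat \<times> nat \<Rightarrow> (real \<times> real) \<times> (real \<times> real) \<times> (real \<times> real) set" where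
  "right_class = (\<lambda>(s, t). (pt (s + 1), pt (t + 2), pt ` {s + 1<..<t + 2}))"

text \<open>A left and a right class with the same ends agree only when no point lies strictly
  between these ends.\<close>

lemma class_eq_iff:
  "left_class x = left_class y \<longleftrightarrow> x = y"
  "right_class x = right_class y \<longleftrightarrow> x = y"
  "left_class x = right_class y \<longleftrightarrow> x = y \<and> snd y \<le> fst y"
proof -
  show "left_class x = left_class y \<longleftrightarrow> x = y" "right_class x = right_class y \<longleftrightarrow> x = y"
    by (cases x; cases y; simp add: left_class_def right_class_def)
      (cases x; cases y; auto simp: left_class_def right_class_def)
  have "{s + 1<..<t + 2} = {} \<longleftrightarrow> t \<le> s" for s t :: nat
  proof
    assume "{s + 1<..<t + 2} = {}"
    then have "s + 2 \<notin> {s + 1<..<t + 2}" by simp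
    then show "t \<le> s" by simp
  qed auto
  then show "left_class x = right_class y \<longleftrightarrow> x = y \<and> snd y \<le> fst y"
    by (cases x; cases y) (auto simp: left_class_def right_class_def)
qed

text \<open>Since \<open>R\<close> has no pair \<open>(k, k)\<close>, none of its right classes is
  also a left class, so \<open>L\<close> and \<open>R\<close> can be recovered by testing membership
  of classes.\<close>

lemma inj_on_diagram: "inj_on (\<lambda>(L, R). left_class ` L \<union> right_class ` R) (arc_pairs m)"
proof (rule inj_onI, clarify)
  fix L R L' R' assume a: "(L, R) \<in> arc_pairs m" "(L', R') \<in> arc_pairs m"
    and eq: "left_class ` L \<union> right_class ` R = left_class ` L' \<union> right_class ` R'"
  have lt: "fst x < snd x" if "x \<in> Q" "(P, Q) \<in> arc_pairs m" for P Q x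
  proof -
    obtain s t where x: "x = (s, t)" by (cases x)
    have "noncrossing_matching Q" "(s, s) \<notin> Q" using that(2) by (simp_all add: arc_pairs_def)
    then have "s \<le> t" "s \<noteq> t" using that(1) noncrossing_matchingD(1)[of Q s t] by (auto simp: x)
    then show ?thesis by (simp add: x)
  qed
  \<comment> \<open>For \<open>x = (k, k)\<close> both classes coincide and may come from
    \<open>P\<close>, hence the condition \<open>fst x < snd x\<close>.\<close>
  have rec: "x \<in> P \<longleftrightarrow> left_class x \<in> left_class ` P \<union> right_class ` Q"
    "x \<in> Q \<longleftrightarrow> fst x < snd x \<and> right_class x \<in> left_class ` P \<union> right_class ` Q"
    if "(P, Q) \<in> arc_pairs m" for P Q x
  proof -
    have "left_class x \<notin> right_class ` Q"
    proof
      assume "left_class x \<in> right_class ` Q"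
      then obtain y where "y \<in> Q" "left_class x = right_class y" by (rule imageE)
      then show False using lt[OF _ that, of y] by (simp add: class_eq_iff)
    qed
    then show "x \<in> P \<longleftrightarrow> left_class x \<in> left_class ` P \<union> right_class ` Q"
      using inj_image_mem_iff[of left_class x P] by (simp add: inj_def class_eq_iff)
    have "right_class x \<notin> left_class ` P" if "fst x < snd x"
    proof
      assume "right_class x \<in> left_class ` P"
      then obtain y where "right_class x = left_class y" by (rule imageE)
      then have "left_class y = right_class x" by (rule sym)
      then show False using that by (simp add: class_eq_iff)
    qed
    then show "x \<in> Q \<longleftrightarrow> fst x < snd x \<and> right_class x \<in> left_class ` P \<union> right_class ` Q"
      using lt[OF _ that, of x] inj_image_mem_iff[of right_class x Q] by (auto simp: inj_def class_eq_iff)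
  qed
  show "L = L' \<and> R = R'"
  proof (intro conjI set_eqI)
    fix x
    show "x \<in> L \<longleftrightarrow> x \<in> L'" using rec(1)[OF a(1), of x] rec(1)[OF a(2), of x] by (simp only: eq)
    show "x \<in> R \<longleftrightarrow> x \<in> R'" using rec(2)[OF a(1), of x] rec(2)[OF a(2), of x] by (simp only: eq)
  qed
qed

section \<open>Diagrams correspond to pairs of matchings\<close>

lemma diagram_in_left_right_diagrams:
  assumes LR: "(L, R) \<in> arc_pairs (n - 1)"
  shows "left_class ` L \<union> right_class ` R \<in> left_right_diagrams n"
proof -
  define arc where "arc = (\<lambda>\<sigma> (s, t). parabola \<sigma> (s + 1) (t + 2))"
  have ncm: "noncrossing_matching L" "noncrossing_matching R"
    and disj: "fst ` L \<inter> fst ` R = {}" "snd ` L \<inter> snd ` R = {}"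
    and sub: "L \<subseteq> {..<n - 1} \<times> {..<n - 1}" "R \<subseteq> {..<n - 1} \<times> {..<n - 1}"
    using LR by (simp_all add: arc_pairs_def)
  \<comment> \<open>Tagging each pair with its coefficient, -1 for left and 1 for right, treats both
    sides uniformly.\<close>
  define S where "S = {-1 :: real} \<times> L \<union> {1} \<times> R"
  define \<Gamma> where "\<Gamma> = (\<lambda>(\<sigma>, x). arc \<sigma> x) ` S"
  have S: "\<sigma> \<in> {-1, 1}" "s \<le> t" "t + 2 \<le> n" if "(\<sigma>, s, t) \<in> S" for \<sigma> :: real and s t
    using that sub noncrossing_matchingD(1)[OF ncm(1), of s t] noncrossing_matchingD(1)[OF ncm(2), of s t]
    by (auto simp: S_def)
  have graph: "height_graph (parabola \<sigma> (s + 1) (t + 2)) (s + 1) (t + 2)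
      (\<lambda>h. \<sigma> * (h - real (s + 1)) * (real (t + 2) - h))" if "(\<sigma>, s, t) \<in> S" for \<sigma> :: real and s t
    using S[OF that] by (intro height_graph_parabola) auto
  have ends: "pathstart (parabola \<sigma> p q) = pt p" "pathfinish (parabola \<sigma> p q) = pt q" for \<sigma> p q
    by (simp_all add: parabola_def pathstart_def pathfinish_def)
  have "noncrossing_drawing n \<Gamma>"
    unfolding noncrossing_drawing_def
  proof (intro conjI ballI impI)
    fix \<gamma> assume "\<gamma> \<in> \<Gamma>"
    then obtain \<sigma> s t where "(\<sigma>, s, t) \<in> S" "\<gamma> = parabola \<sigma> (s + 1) (t + 2)"
      by (auto simp: \<Gamma>_def arc_def)
    then show "drawn_arc n \<gamma>" using S[of \<sigma> s t] by (auto intro!: drawn_arc_parabola)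
  next
    fix \<gamma> \<delta> assume "\<gamma> \<in> \<Gamma>" "\<delta> \<in> \<Gamma>" and ne: "\<gamma> \<noteq> \<delta>"
    then obtain \<sigma> s t \<sigma>' s' t' where x: "(\<sigma>, s, t) \<in> S" "\<gamma> = parabola \<sigma> (s + 1) (t + 2)"
      and y: "(\<sigma>', s', t') \<in> S" "\<delta> = parabola \<sigma>' (s' + 1) (t' + 2)"
      by (auto simp: \<Gamma>_def arc_def)
    have "s \<noteq> s' \<and> t \<noteq> t' \<and> (\<sigma> = \<sigma>' \<longrightarrow> \<not> (s < s' \<and> s' \<le> t \<and> t < t') \<and> \<not> (s' < s \<and> s \<le> t' \<and> t' < t))"
    proof (cases "\<sigma> = \<sigma>'")
      case True
      then have "(s, t) \<noteq> (s', t')" using ne x y by auto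
      moreover have "\<exists>M. noncrossing_matching M \<and> (s, t) \<in> M \<and> (s', t') \<in> M"
        using x(1) y(1) True ncm by (auto simp: S_def)
      then obtain M where M: "noncrossing_matching M" "(s, t) \<in> M" "(s', t') \<in> M" by blast
      ultimately show ?thesis
        using noncrossing_matchingD(2,3)[OF M] noncrossing_matchingD(3)[OF M(1,3,2)] by auto
    next
      case False
      then have "(s, t) \<in> L \<and> (s', t') \<in> R \<or> (s, t) \<in> R \<and> (s', t') \<in> L"
        using x(1) y(1) by (auto simp: S_def)
      then have "s \<noteq> s' \<and> t \<noteq> t'"
        using disj by (auto simp: disjoint_iff) (metis fst_conv image_eqI snd_conv)+
      then show ?thesis using False by simp
    qed
    then have nc: "s \<noteq> s'" "t \<noteq> t'"
      "\<sigma> = \<sigma>' \<Longrightarrow> \<not> (s < s' \<and> s' \<le> t \<and> t < t') \<and> \<not> (s' < s \<and> s \<le> t' \<and> t' < t)" by auto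
    then show "pathstart \<gamma> \<noteq> pathstart \<delta>" "pathfinish \<gamma> \<noteq> pathfinish \<delta>"
      by (simp_all add: x y ends)
    \<comment> \<open>In terms of points, \<open>s' \<le> t\<close> reads
      \<open>s' + 1 < t + 2\<close>, so \<open>nc\<close> supplies the condition on interleaving in
      \<open>parabolas_disjoint\<close>.\<close>
    show "path_image \<gamma> \<inter> path_image \<delta> \<subseteq> {pathstart \<gamma>, pathfinish \<gamma>} \<inter> {pathstart \<delta>, pathfinish \<delta>}"
      unfolding x(2) y(2) ends
      using S[OF x(1)] S[OF y(1)] nc by (intro parabolas_disjoint) auto
  qed
  moreover have cl: "left_arc n (arc (-1) x) \<and> arc_class n (arc (-1) x) = left_class x" if "x \<in> L" for x
  proof -
    obtain s t where st: "x = (s, t)" by (cases x)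
    then have m: "(-1, s, t) \<in> S" using that by (simp add: S_def)
    have "left_arc n (parabola (-1) (s + 1) (t + 2))"
      using S[OF m] by (intro left_arc_parabola) auto
    then show ?thesis
      using arc_class_left_arc[OF graph[OF m]] by (simp add: st arc_def left_class_def)
  qed
  moreover have cr: "right_arc n (arc 1 x) \<and> arc_class n (arc 1 x) = right_class x" if "x \<in> R" for x
  proof -
    obtain s t where st: "x = (s, t)" by (cases x)
    then have m: "(1, s, t) \<in> S" using that by (simp add: S_def)
    have "right_arc n (parabola 1 (s + 1) (t + 2))"
      using S[OF m] by (intro right_arc_parabola) auto
    then show ?thesis
      using arc_class_right_arc[OF graph[OF m]] S[OF m] by (simp add: st arc_def right_class_def)
  qed
  have \<Gamma>: "\<Gamma> = arc (-1) ` L \<union> arc 1 ` R" unfolding \<Gamma>_def S_def by (auto simp: image_iff)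
  have "arc_class n ` \<Gamma> = left_class ` L \<union> right_class ` R"
    unfolding \<Gamma> image_Un image_image using cl cr by simp
  moreover have "\<forall>\<gamma>\<in>\<Gamma>. left_arc n \<gamma> \<or> right_arc n \<gamma>" unfolding \<Gamma> using cl cr by blast
  ultimately show ?thesis unfolding left_right_diagrams_def by blast
qed

text \<open>The point \<open>p'\<close> is interior to the first arc and \<open>q\<close> to the
  second, so the common side gives \<open>g\<close> and \<open>g'\<close> the same sign
  there.\<close>

lemma interleaved_same_side_arcs_cross:
  assumes \<gamma>: "height_graph \<gamma> p q g" and \<delta>: "height_graph \<delta> p' q' g'"
    and range: "1 \<le> p" "q \<le> n" "1 \<le> p'" "q' \<le> n"
    and side: "left_arc n \<gamma> \<and> left_arc n \<delta> \<or> right_arc n \<gamma> \<and> right_arc n \<delta>"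
    and less: "p < p'" "p' < q" "q < q'"
  shows "\<not> path_image \<gamma> \<inter> path_image \<delta> \<subseteq> {pathstart \<gamma>, pathfinish \<gamma>} \<inter> {pathstart \<delta>, pathfinish \<delta>}"
proof (rule interleaved_height_graphs_meet[OF \<gamma> \<delta> less])
  have "g (real p') < 0 \<and> g' (real q) < 0 \<or> 0 < g (real p') \<and> 0 < g' (real q)"
    using side less
    unfolding height_graph_left_arc[OF \<gamma> range(1,2)] height_graph_left_arc[OF \<delta> range(3,4)]
      height_graph_right_arc[OF \<gamma> range(1,2)] height_graph_right_arc[OF \<delta> range(3,4)]
    by blast
  then show "0 < g (real p') * g' (real q)" by (auto simp: zero_less_mult_iff)
qed

text \<open>The two matchings are read off the drawing: the forced crossing of interleaved arcs
  makes each side noncrossing, and (C2) keeps the ends of the two sides apart.\<close>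

lemma left_right_diagram_from_arc_pairs:
  assumes nc: "noncrossing_drawing n \<Gamma>" and side: "\<forall>\<gamma>\<in>\<Gamma>. left_arc n \<gamma> \<or> right_arc n \<gamma>"
  shows "arc_class n ` \<Gamma> \<in> (\<lambda>(L, R). left_class ` L \<union> right_class ` R) ` arc_pairs (n - 1)"
proof -
  define J where "J \<gamma> s t \<longleftrightarrow> \<gamma> \<in> \<Gamma> \<and> pathstart \<gamma> = pt (s + 1) \<and> pathfinish \<gamma> = pt (t + 2)" for \<gamma> s t
  have graph: "\<exists>g. height_graph \<gamma> (s + 1) (t + 2) g \<and> t + 2 \<le> n" if "J \<gamma> s t" for \<gamma> s t
  proof -
    have "drawn_arc n \<gamma>" using that nc by (simp add: J_def noncrossing_drawing_def)
    then obtain p q g where pqg: "1 \<le> p" "q \<le> n" "height_graph \<gamma> p q g"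
      by (rule drawn_arc_height_graph)
    then have "p = s + 1" "q = t + 2" using that by (auto simp: J_def height_graph_def)
    with pqg show ?thesis by blast
  qed
  have J_le: "s \<le> t" "t + 2 \<le> n" if "J \<gamma> s t" for \<gamma> s t
    using graph[OF that] by (auto simp: height_graph_def)
  have J_ex: "\<exists>s t. J \<gamma> s t" if "\<gamma> \<in> \<Gamma>" for \<gamma>
  proof -
    have "drawn_arc n \<gamma>" using that nc by (simp add: noncrossing_drawing_def)
    then obtain p q g where pqg: "1 \<le> p" "q \<le> n" "height_graph \<gamma> p q g"
      by (rule drawn_arc_height_graph)
    \<comment> \<open>The truncated subtractions are exact because \<open>1 \<le> p\<close> and
      \<open>p < q\<close>.\<close>
    then have "J \<gamma> (p - 1) (q - 2)" using that by (auto simp: J_def height_graph_def)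
    then show ?thesis by blast
  qed
  have J_apart: "s \<noteq> s' \<and> t \<noteq> t' \<and>
      path_image \<gamma> \<inter> path_image \<delta> \<subseteq> {pathstart \<gamma>, pathfinish \<gamma>} \<inter> {pathstart \<delta>, pathfinish \<delta>}"
    if "J \<gamma> s t" "J \<delta> s' t'" "\<gamma> \<noteq> \<delta>" for \<gamma> \<delta> s t s' t'
  proof -
    have "\<gamma> \<in> \<Gamma>" "\<delta> \<in> \<Gamma>" using that by (simp_all add: J_def)
    then have "path_image \<gamma> \<inter> path_image \<delta>
          \<subseteq> {pathstart \<gamma>, pathfinish \<gamma>} \<inter> {pathstart \<delta>, pathfinish \<delta>} \<and>
        pathstart \<gamma> \<noteq> pathstart \<delta> \<and> pathfinish \<gamma> \<noteq> pathfinish \<delta>"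
      using nc that(3) unfolding noncrossing_drawing_def by metis
    then show ?thesis using that(1,2) by (auto simp: J_def)
  qed
  have J_eq: "s = s' \<and> t = t'" if "J \<gamma> s t" "J \<gamma> s' t'" for \<gamma> s t s' t'
    using that by (simp add: J_def)
  have matching: "noncrossing_matching M"
    if M: "\<And>s t. (s, t) \<in> M \<Longrightarrow> \<exists>\<gamma>. J \<gamma> s t \<and> side n \<gamma>" and "side = left_arc \<or> side = right_arc"
    for M and side :: "nat \<Rightarrow> (real \<Rightarrow> real \<times> real) \<Rightarrow> bool"
  proof (rule noncrossing_matchingI)
    show "s \<le> t" if "(s, t) \<in> M" for s t using M[OF that] J_le by blast
    fix s t s' t' assume "(s, t) \<in> M" "(s', t') \<in> M" and ne: "(s, t) \<noteq> (s', t')"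
    then obtain \<gamma> \<delta> where \<gamma>: "J \<gamma> s t" "side n \<gamma>" and \<delta>: "J \<delta> s' t'" "side n \<delta>"
      using M by metis
    have "\<gamma> \<noteq> \<delta>" using J_eq[of \<gamma> s t s' t'] \<gamma> \<delta> ne by auto
    note apart = J_apart[OF \<gamma>(1) \<delta>(1) this]
    obtain g g' where g: "height_graph \<gamma> (s + 1) (t + 2) g" and g': "height_graph \<delta> (s' + 1) (t' + 2) g'"
      using graph \<gamma>(1) \<delta>(1) by metis
    have "left_arc n \<gamma> \<and> left_arc n \<delta> \<or> right_arc n \<gamma> \<and> right_arc n \<delta>"
      using \<gamma>(2) \<delta>(2) that(2) by auto
    then have "\<not> (s < s' \<and> s' \<le> t \<and> t < t')"
      using interleaved_same_side_arcs_cross[OF g g', of n] J_le(2)[OF \<gamma>(1)] J_le(2)[OF \<delta>(1)] apart by auto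
    then show "s \<noteq> s' \<and> t \<noteq> t' \<and> \<not> (s < s' \<and> s' \<le> t \<and> t < t')" using apart by simp
  qed
  define L where "L = {(s, t). \<exists>\<gamma>. J \<gamma> s t \<and> left_arc n \<gamma>}"
  \<comment> \<open>The condition \<open>s < t\<close> keeps arcs between consecutive points, which
    are both left and right, in \<open>L\<close> only.\<close>
  define R where "R = {(s, t). s < t \<and> (\<exists>\<gamma>. J \<gamma> s t \<and> right_arc n \<gamma>)}"
  \<comment> \<open>Point \<open>s + 2\<close> lies strictly between the ends, and \<open>g\<close>
    cannot be both negative and positive there.\<close>
  have not_both: "\<not> (left_arc n \<gamma> \<and> right_arc n \<gamma>)" if J: "J \<gamma> s t" and lt: "s < t" for \<gamma> s t
  proof -
    obtain g where g: "height_graph \<gamma> (s + 1) (t + 2) g" "t + 2 \<le> n" using graph[OF J] by blast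
    then show ?thesis
      using height_graph_left_arc[OF g(1) _ g(2)] height_graph_right_arc[OF g(1) _ g(2)] lt
      by (auto dest!: spec[of _ "s + 2"])
  qed
  have LR_apart: "s \<noteq> s' \<and> t \<noteq> t'" if l: "(s, t) \<in> L" and r: "(s', t') \<in> R" for s t s' t'
  proof -
    obtain \<gamma> \<delta> where \<gamma>: "J \<gamma> s t" "left_arc n \<gamma>" and \<delta>: "J \<delta> s' t'" "right_arc n \<delta>" "s' < t'"
      using l r by (auto simp: L_def R_def)
    have "\<gamma> \<noteq> \<delta>" using not_both[OF \<delta>(1,3)] \<gamma>(2) \<delta>(2) by auto
    then show ?thesis using J_apart[OF \<gamma>(1) \<delta>(1)] by simp
  qed
  have "(L, R) \<in> arc_pairs (n - 1)"
  proof -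
    have "L \<subseteq> {..<n - 1} \<times> {..<n - 1}" "R \<subseteq> {..<n - 1} \<times> {..<n - 1}"
      using J_le by (fastforce simp: L_def R_def)+
    moreover have "noncrossing_matching L"
      by (rule matching[of L left_arc]) (simp_all add: L_def)
    moreover have "noncrossing_matching R"
      by (rule matching[of R right_arc]) (simp_all add: R_def)
    moreover have "fst ` L \<inter> fst ` R = {}" "snd ` L \<inter> snd ` R = {}"
      using LR_apart by (auto simp: disjoint_iff)
    moreover have "\<forall>k. (k, k) \<notin> R" by (simp add: R_def)
    ultimately show ?thesis by (simp add: arc_pairs_def)
  qed
  moreover have "arc_class n ` \<Gamma> = left_class ` L \<union> right_class ` R"
  proof -
    have cl: "arc_class n \<gamma> = left_class (s, t)" if J: "J \<gamma> s t" and l: "left_arc n \<gamma>" for \<gamma> s t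
      using graph[OF J] arc_class_left_arc l by (auto simp: left_class_def)
    have cr: "arc_class n \<gamma> = right_class (s, t)" if J: "J \<gamma> s t" and r: "right_arc n \<gamma>" for \<gamma> s t
      using graph[OF J] arc_class_right_arc[of \<gamma> "s + 1" "t + 2" _ n] r by (auto simp: right_class_def)
    have short: "left_arc n \<gamma>" if J: "J \<gamma> s t" and le: "\<not> s < t" for \<gamma> s t
    proof -
      obtain g where g: "height_graph \<gamma> (s + 1) (t + 2) g" "t + 2 \<le> n" using graph[OF J] by blast
      show ?thesis using height_graph_left_arc[OF g(1) _ g(2)] le by simp
    qed
    show ?thesis
    proof (intro equalityI subsetI)
      fix c assume "c \<in> arc_class n ` \<Gamma>"
      then obtain \<gamma> where \<gamma>: "\<gamma> \<in> \<Gamma>" "c = arc_class n \<gamma>" by (rule imageE)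
      then obtain s t where J: "J \<gamma> s t" using J_ex by blast
      show "c \<in> left_class ` L \<union> right_class ` R"
      proof (cases "left_arc n \<gamma>")
        case True
        then have "(s, t) \<in> L" using J by (auto simp: L_def)
        then show ?thesis using cl[OF J True] \<gamma>(2) by simp
      next
        case False
        then have "right_arc n \<gamma>" "s < t" using side \<gamma>(1) short[OF J] by auto
        then have "(s, t) \<in> R" using J by (auto simp: R_def)
        then show ?thesis using cr[OF J \<open>right_arc n \<gamma>\<close>] \<gamma>(2) by simp
      qed
    next
      fix c assume "c \<in> left_class ` L \<union> right_class ` R"
      then obtain s t \<gamma> where "J \<gamma> s t" "c = arc_class n \<gamma>"
        unfolding L_def R_def using cl cr by auto
      then show "c \<in> arc_class n ` \<Gamma>" by (simp add: J_def)
    qed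
  qed
  ultimately show ?thesis by (auto intro!: image_eqI[of _ _ "(L, R)"])
qed

lemma card_left_right_diagrams: "card (left_right_diagrams n) = card (arc_pairs (n - 1))"
proof -
  let ?D = "\<lambda>(L, R). left_class ` L \<union> right_class ` R"
  have "left_right_diagrams n = ?D ` arc_pairs (n - 1)"
  proof (intro equalityI subsetI)
    fix X assume "X \<in> left_right_diagrams n"
    then obtain \<Gamma> where "X = arc_class n ` \<Gamma>" "noncrossing_drawing n \<Gamma>"
      "\<forall>\<gamma>\<in>\<Gamma>. left_arc n \<gamma> \<or> right_arc n \<gamma>" unfolding left_right_diagrams_def by blast
    then show "X \<in> ?D ` arc_pairs (n - 1)" using left_right_diagram_from_arc_pairs by simp
  next
    fix X assume "X \<in> ?D ` arc_pairs (n - 1)"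
    then obtain x where x: "x \<in> arc_pairs (n - 1)" "X = ?D x" by (rule imageE)
    then show "X \<in> left_right_diagrams n"
      by (cases x) (simp add: diagram_in_left_right_diagrams)
  qed
  then show ?thesis using card_image[OF inj_on_diagram] by simp
qed

theorem theorem1p1:
  fixes n :: nat
  assumes "n \<ge> 1"
  shows "real (card (left_right_diagrams n)) = baxter_number n"
proof -
  \<comment> \<open>With \<open>n = m + 1\<close>, the binomials of \<open>m + 2\<close> are those
    of \<open>n + 1\<close>, and the sum up to \<open>m\<close> is the one up to
    \<open>n - 1\<close>.\<close>
  obtain m where n: "n = Suc m" using assms by (metis Suc_le_D One_nat_def)
  have "real (card (left_right_diagrams n)) = real (walks m 0 0)"
    by (simp add: n card_left_right_diagrams card_arc_pairs)
  then show ?thesis unfolding walks_closed baxter_number_def by (simp add: n)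
qed

end
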